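(* Let $A\in\mathbb{F}^{n\times n}$ and let $Q\in\mathbb{F}^{n\times n}$ be Hermitian. Suppose that $f$ is a continuous map from $\mathbb{P}^{n\times n}$ into itself and that the set $S:=\{X_S>0 : X_S\le Q-A^{H}f(X_S)^{-1}A\}$ is nonempty. Let $\{(A^{(k)},B^{(k)},Q^{(k)})\}_{k\ge1}$ be the sequence defined in the context. Then the following statements hold. (1) $Q^{(\infty)}:=\lim_{\ell\to\infty}Q^{(\ell)}$ is the maximal positive definite solution of $X+A^{H}f(X)^{-1}A=Q$. (2) If $A$ is nonsingular, then $Q-B^{(\infty)}:=Q-\lim_{\ell\to\infty}B^{(\ell)}$ is the maximal positive definite solution of the dual equation $\widetilde X=Q-f(A)f(\widetilde X)^{-1}f(A)^{H}$. (3) If $A$ is nonsingular, then $B^{(\infty)}$ is the minimal positive definite solution of $X+A^{H}f(X)^{-1}A=Q$.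
   Context: $\mathbb{F}$ is $\mathbb{R}$ or $\mathbb{C}$; $M^H$ is the conjugate transpose of $M$; for Hermitian matrices, $X>Y$ ($X\ge Y$) means $X-Y$ is positive definite (positive semidefinite). $\mathbb{P}^{n\times n}$ is the set of positive definite matrices in $\mathbb{F}^{n\times n}$. The map $f:\mathbb{F}^{n\times n}\to\mathbb{F}^{n\times n}$ satisfies, for all $M,N\in\mathbb{F}^{n\times n}$: (a1) $f(f(M))=M$; (a2) $f(M+N)=f(M)+f(N)$; (a3) $f(MN)=f(M)f(N)$; (a4) $f(M)\ge0$ whenever $M\ge 0$. Sequence: $A^{(1)}:=f(A)f(Q)^{-1}A$, $B^{(1)}:=f(A)f(Q)^{-1}f(A)^H$, $Q^{(1)}:=Q-A^Hf(Q)^{-1}A$, and for $k>1$: $A^{(k)}:=A^{(1)}(Q^{(1)}-B^{(k-1)})^{-1}A^{(k-1)}$, $B^{(k)}:=B^{(1)}+A^{(1)}(Q^{(1)}-B^{(k-1)})^{-1}(A^{(1)})^H$, $Q^{(k)}:=Q^{(k-1)}-(A^{(k-1)})^H(Q^{(1)}-B^{(k-1)})^{-1}A^{(k-1)}$. A positive definite solution $X_M$ of an equation is called maximal (minimal) if $X_M\ge X$ ($X_M\le X$) for every Hermitian solution $X$ of that equation. *)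

theory Defs
  imports "HOL-Analysis.Analysis" "Jordan_Normal_Form.Conjugate"
begin

section \<open>The scalar field\<close>

text \<open>
  The field is \<open>real\<close> (with trivial conjugation) or \<open>complex\<close> (with \<open>cnj\<close>).  Both are covered at
  once by the following class; the lemma \<open>real_or_complex_cases\<close> below shows that it has no further
  instances up to isomorphism.
\<close>

class real_or_complex = real_normed_field + conjugatable_field +
  assumes mult_conjugate_scaleR: "x * conjugate x = (norm x)\<^sup>2 *\<^sub>R 1"

instance real :: real_or_complex
  by intro_classes (simp add: power2_eq_square)

instance complex :: real_or_complex
  by intro_classes (simp only: conjugate_complex_def complex_norm_square scaleR_conv_of_real mult_1_right)

lemma mult_conjugate: "x * conjugate x = (of_real ((norm x)\<^sup>2) :: 'a :: real_or_complex)"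
  by (simp only: mult_conjugate_scaleR of_real_def)

lemma conjugate_of_real [simp]:
  "conjugate (of_real r :: 'a :: real_or_complex) = of_real r"
proof (cases "r = 0")
  case False
  have "of_real r * conjugate (of_real r :: 'a) = of_real r * of_real r"
    using mult_conjugate[of "of_real r :: 'a"] by (simp add: power2_eq_square)
  with False show ?thesis by simp
qed simp

lemma add_conjugate_Reals: "x + conjugate x \<in> (\<real> :: 'a :: real_or_complex set)"
proof -
  have "conjugate (1 :: 'a) = 1" using conjugate_of_real[of 1, where 'a = 'a] by simp
  then have "x + conjugate x = (1 + x) * conjugate (1 + x) - 1 - x * conjugate x"
    by (simp add: conjugate_dist_add algebra_simps)
  also have "\<dots> = of_real ((norm (1 + x))\<^sup>2 - 1 - (norm x)\<^sup>2)"
    unfolding mult_conjugate by simp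
  finally show ?thesis by (simp only: Reals_of_real)
qed

lemma real_or_complex_cases:
  "(\<forall>x :: 'a :: real_or_complex. x \<in> \<real>) \<or>
   (\<exists>i :: 'a. i\<^sup>2 = -1 \<and> conjugate i = - i \<and> (\<forall>x. \<exists>a b. x = of_real a + of_real b * i))"
proof (cases "\<forall>x :: 'a. x \<in> \<real>")
  case True
  then show ?thesis by (rule disjI1)
next
  case False
  have minus: "conjugate (x - y) = conjugate x - conjugate y" for x y :: 'a
    using conjugate_dist_add[of x "- y"] by (simp add: conjugate_neg)
  have fixed: "u \<in> \<real>" if "conjugate u = u" for u :: 'a
  proof -
    have "u = (u + conjugate u) / 2" using that by simp
    then show ?thesis using add_conjugate_Reals[of u] by (metis Reals_divide Reals_numeral)
  qed
  obtain x :: 'a where x: "x \<notin> \<real>" using False by blast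
  define y where "y = x - conjugate x"
  have y: "conjugate y = - y" "y \<noteq> 0" unfolding y_def using fixed[of x] x by (auto simp: minus)
  define i where "i = y / of_real (norm y)"
  have iy: "i * of_real (norm y) = y" using y by (simp add: i_def)
  then have "conjugate i * of_real (norm y) = - i * of_real (norm y)"
    using y by (metis conjugate_dist_mul conjugate_of_real mult_minus_left)
  then have ci: "conjugate i = - i"
    using y(2) by (metis mult_right_cancel norm_eq_zero of_real_eq_0_iff)
  have "norm i = 1" using y by (simp add: i_def norm_divide)
  then have "- (i * i) = 1" using mult_conjugate[of i] ci by simp
  then have i2: "i * i = -1" by (metis minus_minus)
  have "\<exists>a b. z = of_real a + of_real b * i" for z
  proof -
    obtain a where a: "z + conjugate z = of_real a" using add_conjugate_Reals[of z] by (auto elim: Reals_cases)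
    have "conjugate (- i * (z - conjugate z)) = - i * (z - conjugate z)"
      by (simp add: conjugate_dist_mul conjugate_neg ci minus right_diff_distrib)
    from fixed[OF this] obtain b where b: "- i * (z - conjugate z) = of_real b" by (auto elim: Reals_cases)
    have "z - conjugate z = - (i * i) * (z - conjugate z)" by (simp add: i2)
    also have "\<dots> = (- i * (z - conjugate z)) * i" by (simp only: mult.assoc mult.commute mult.left_commute mult_minus_left mult_minus_right)
    also have "\<dots> = of_real b * i" by (simp only: b)
    finally have "(z + conjugate z) + (z - conjugate z) = of_real a + of_real b * i"
      by (simp only: a)
    moreover have "(z + conjugate z) + (z - conjugate z) = 2 * z" by simp
    ultimately have "2 * z = of_real a + of_real b * i" by (simp only:)
    moreover have "2 * (of_real (a / 2) + of_real (b / 2) * i) = of_real a + of_real b * i"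
      by (simp add: distrib_left)
    ultimately have "2 * z = 2 * (of_real (a / 2) + of_real (b / 2) * i)" by (simp only:)
    then have "z = of_real (a / 2) + of_real (b / 2) * i"
      by (metis mult_left_cancel zero_neq_numeral)
    then show ?thesis by (intro exI)
  qed
  then have all: "\<forall>x. \<exists>a b. x = of_real a + of_real b * i" by (rule allI)
  have "i\<^sup>2 = -1" by (simp only: power2_eq_square i2)
  with ci all show ?thesis by (intro disjI2 exI[of _ i] conjI)
qed


section \<open>Hermitian matrices and the Loewner order\<close>

definition conj_transpose ::
    "'a :: conjugate ^ 'n ^ 'm \<Rightarrow> 'a ^ 'm ^ 'n"  ("_\<^sup>H" [1000] 999) where
  "M\<^sup>H = (\<chi> i j. conjugate (M $ j $ i))"

definition hermitian :: "'a :: conjugate ^ 'n ^ 'n \<Rightarrow> bool" where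
  "hermitian M \<longleftrightarrow> M\<^sup>H = M"

text \<open>The scalar \<open>x\<^sup>H M x\<close>.\<close>

definition quad_form :: "'a :: real_or_complex ^ 'n ^ 'n \<Rightarrow> 'a ^ 'n \<Rightarrow> 'a" where
  "quad_form M x = (\<Sum>i\<in>UNIV. conjugate (x $ i) * (M *v x) $ i)"

definition pos_def :: "'a :: real_or_complex ^ 'n ^ 'n \<Rightarrow> bool" where
  "pos_def M \<longleftrightarrow> hermitian M \<and> (\<forall>x. x \<noteq> 0 \<longrightarrow> (\<exists>r :: real. r > 0 \<and> quad_form M x = of_real r))"

definition pos_semidef :: "'a :: real_or_complex ^ 'n ^ 'n \<Rightarrow> bool" where
  "pos_semidef M \<longleftrightarrow> hermitian M \<and> (\<forall>x. \<exists>r :: real. r \<ge> 0 \<and> quad_form M x = of_real r)"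

definition loewner_le ::
    "'a :: real_or_complex ^ 'n ^ 'n \<Rightarrow> 'a ^ 'n ^ 'n \<Rightarrow> bool"  (infix "\<preceq>" 50) where
  "X \<preceq> Y \<longleftrightarrow> pos_semidef (Y - X)"


section \<open>The matrix equations\<close>

text \<open>
  \<open>matrix_inv M\<close> is an unspecified matrix when \<open>M\<close> is singular, so that being a solution includes
  the invertibility of \<open>f X\<close>.
\<close>

definition primal_solution ::
    "('a ^ 'n ^ 'n \<Rightarrow> 'a ^ 'n ^ 'n) \<Rightarrow> 'a ^ 'n ^ 'n \<Rightarrow> 'a ^ 'n ^ 'n \<Rightarrow>
      'a :: real_or_complex ^ 'n ^ 'n \<Rightarrow> bool" where
  "primal_solution f A Q X \<longleftrightarrow>
     invertible (f X) \<and> X + A\<^sup>H ** matrix_inv (f X) ** A = Q"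

definition dual_solution ::
    "('a ^ 'n ^ 'n \<Rightarrow> 'a ^ 'n ^ 'n) \<Rightarrow> 'a ^ 'n ^ 'n \<Rightarrow> 'a ^ 'n ^ 'n \<Rightarrow>
      'a :: real_or_complex ^ 'n ^ 'n \<Rightarrow> bool" where
  "dual_solution f A Q X \<longleftrightarrow>
     invertible (f X) \<and> X = Q - f A ** matrix_inv (f X) ** (f A)\<^sup>H"

text \<open>Extremality is with respect to all Hermitian solutions, not only the positive definite ones.\<close>

definition maximal_pd_solution ::
    "('a :: real_or_complex ^ 'n ^ 'n \<Rightarrow> bool) \<Rightarrow> 'a ^ 'n ^ 'n \<Rightarrow> bool" where
  "maximal_pd_solution sol X \<longleftrightarrow>
     pos_def X \<and> sol X \<and> (\<forall>Y. hermitian Y \<and> sol Y \<longrightarrow> Y \<preceq> X)"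

definition minimal_pd_solution ::
    "('a :: real_or_complex ^ 'n ^ 'n \<Rightarrow> bool) \<Rightarrow> 'a ^ 'n ^ 'n \<Rightarrow> bool" where
  "minimal_pd_solution sol X \<longleftrightarrow>
     pos_def X \<and> sol X \<and> (\<forall>Y. hermitian Y \<and> sol Y \<longrightarrow> X \<preceq> Y)"


section \<open>The iteration\<close>

definition A_init ::
    "('a ^ 'n ^ 'n \<Rightarrow> 'a ^ 'n ^ 'n) \<Rightarrow> 'a ^ 'n ^ 'n \<Rightarrow> 'a ^ 'n ^ 'n \<Rightarrow>
      'a :: real_or_complex ^ 'n ^ 'n" where
  "A_init f A Q = f A ** matrix_inv (f Q) ** A"

definition B_init ::
    "('a ^ 'n ^ 'n \<Rightarrow> 'a ^ 'n ^ 'n) \<Rightarrow> 'a ^ 'n ^ 'n \<Rightarrow> 'a ^ 'n ^ 'n \<Rightarrow>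
      'a :: real_or_complex ^ 'n ^ 'n" where
  "B_init f A Q = f A ** matrix_inv (f Q) ** (f A)\<^sup>H"

definition Q_init ::
    "('a ^ 'n ^ 'n \<Rightarrow> 'a ^ 'n ^ 'n) \<Rightarrow> 'a ^ 'n ^ 'n \<Rightarrow> 'a ^ 'n ^ 'n \<Rightarrow>
      'a :: real_or_complex ^ 'n ^ 'n" where
  "Q_init f A Q = Q - A\<^sup>H ** matrix_inv (f Q) ** A"

text \<open>
  The sequences are indexed from 0 here and from 1 in the usual notation: \<open>A_seq f A Q k\<close> is the
  matrix written \<open>A\<close> with superscript \<open>(k+1)\<close>, and likewise for \<open>B_seq\<close> and \<open>Q_seq\<close>.
\<close>

primrec B_seq ::
    "('a ^ 'n ^ 'n \<Rightarrow> 'a ^ 'n ^ 'n) \<Rightarrow> 'a ^ 'n ^ 'n \<Rightarrow> 'a ^ 'n ^ 'n \<Rightarrow> nat \<Rightarrow>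
      'a :: real_or_complex ^ 'n ^ 'n" where
  "B_seq f A Q 0 = B_init f A Q"
| "B_seq f A Q (Suc k) =
     B_init f A Q + A_init f A Q ** matrix_inv (Q_init f A Q - B_seq f A Q k) ** (A_init f A Q)\<^sup>H"

primrec A_seq ::
    "('a ^ 'n ^ 'n \<Rightarrow> 'a ^ 'n ^ 'n) \<Rightarrow> 'a ^ 'n ^ 'n \<Rightarrow> 'a ^ 'n ^ 'n \<Rightarrow> nat \<Rightarrow>
      'a :: real_or_complex ^ 'n ^ 'n" where
  "A_seq f A Q 0 = A_init f A Q"
| "A_seq f A Q (Suc k) =
     A_init f A Q ** matrix_inv (Q_init f A Q - B_seq f A Q k) ** A_seq f A Q k"

primrec Q_seq ::
    "('a ^ 'n ^ 'n \<Rightarrow> 'a ^ 'n ^ 'n) \<Rightarrow> 'a ^ 'n ^ 'n \<Rightarrow> 'a ^ 'n ^ 'n \<Rightarrow> nat \<Rightarrow>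
      'a :: real_or_complex ^ 'n ^ 'n" where
  "Q_seq f A Q 0 = Q_init f A Q"
| "Q_seq f A Q (Suc k) =
     Q_seq f A Q k -
     (A_seq f A Q k)\<^sup>H ** matrix_inv (Q_init f A Q - B_seq f A Q k) ** A_seq f A Q k"

end

theory Submission
  imports Defs
begin

text \<open>
  Write \<open>F(X) = Q - A\<^sup>H f(X)\<^sup>-\<^sup>1 A\<close> (\<open>step\<close> below), so that the solutions of the primal equation are the fixed points of
  \<open>F\<close>.  On positive definite matrices \<open>F\<close> is monotone for the Loewner order, it never exceeds \<open>Q\<close>,
  and a member \<open>Y\<close> of the given nonempty set is a point with \<open>Y \<le> F(Y)\<close>.  Hence the iterates
  \<open>F\<^sup>k(Q)\<close> decrease and stay above \<open>Y\<close>; they converge to a positive definite fixed point, which lies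
  above every positive definite solution (\<open>iterates_converge_to_maximal_solution\<close>).

  The sequence in the theorem is the subsequence of odd iterates.  The Woodbury identity turns \<open>F\<^sup>2\<close>
  into \<open>X \<mapsto> Q\<^sub>1 - A\<^sub>1\<^sup>H (X - B\<^sub>1)\<^sup>-\<^sup>1 A\<^sub>1\<close>, and maps of this shape are closed under composition: the
  recursion for \<open>(A\<^sub>k, B\<^sub>k, Q\<^sub>k)\<close> is exactly the composition rule, so \<open>F\<^sup>2\<^sup>k(X) = Q\<^sub>k - A\<^sub>k\<^sup>H (X - B\<^sub>k)\<^sup>-\<^sup>1 A\<^sub>k\<close>
  (\<open>iterate_formula\<close>, in the indexing from 1).  Inserting \<open>X = Q\<^sub>1 = F(Q)\<close> gives
  \<open>Q\<^sub>k\<^sub>+\<^sub>1 = F\<^sup>2\<^sup>k\<^sup>+\<^sup>1(Q)\<close>.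

  Maximality is claimed among all Hermitian solutions, and monotonicity of \<open>F\<close> is available only for
  positive definite ones.  The gap closes because every Hermitian solution is positive definite.
  By the two-step formula, \<open>W = X - B\<^sub>1\<close> satisfies \<open>W + A\<^sub>1\<^sup>H W\<^sup>-\<^sup>1 A\<^sub>1 = Q\<^sub>1 - B\<^sub>1\<close>, in which \<open>f\<close> has disappeared,
  and for that equation an argument with a telescoping sum of squares works over both scalar fields
  at once (\<open>hermitian_solution_pos_def\<close>).

  The dual equation is the primal equation with \<open>f(A)\<^sup>H\<close> in place of \<open>A\<close>, and \<open>Q - B\<^sub>k\<close> are the odd
  iterates that belong to it.  This identification needs \<open>f(M\<^sup>H) = f(M)\<^sup>H\<close>, which is a consequence of
  the axioms on \<open>f\<close> (\<open>f_conj_transpose\<close>).  For invertible \<open>A\<close>, the map \<open>X \<mapsto> A\<^sup>H f(X)\<^sup>-\<^sup>1 A\<close> carries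
  primal to dual subsolutions, and on solutions it is the order-reversing map \<open>X \<mapsto> Q - X\<close>.  So part (2) is part (1)
  for the dual data, and part (3) is part (2) read through \<open>X \<mapsto> Q - X\<close>.
\<close>

section \<open>Real inner product on coordinate vectors\<close>

text \<open>
  The element \<open>(z + conjugate z) / 2\<close> lies in \<open>\<real>\<close>, and the description operator extracts the real
  number that it embeds.
\<close>

definition re_part :: "'a :: real_or_complex \<Rightarrow> real" where
  "re_part z = (THE r. of_real r = (z + conjugate z) / 2)"

lemma of_real_re_part: "of_real (re_part z) = (z + conjugate z :: 'a :: real_or_complex) / 2"
proof -
  have "(z + conjugate z) / 2 \<in> \<real>"
    using add_conjugate_Reals[of z] by (metis Reals_divide Reals_numeral)
  then obtain r where r: "(z + conjugate z) / 2 = of_real r" by (rule Reals_cases)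
  have "re_part z = r" unfolding re_part_def r by (rule the_equality) simp_all
  then show ?thesis by (simp only: r)
qed

lemma re_part_eqI: "of_real r = (z + conjugate z :: 'a :: real_or_complex) / 2 \<Longrightarrow> re_part z = r"
  by (simp only: of_real_re_part[symmetric] of_real_eq_iff)

lemma re_part_of_real [simp]: "re_part (of_real r :: 'a :: real_or_complex) = r"
  by (rule re_part_eqI) simp

lemma of_real_re_part_fixed:
  "conjugate z = z \<Longrightarrow> of_real (re_part z) = (z :: 'a :: real_or_complex)"
  unfolding of_real_re_part by simp

lemma re_part_add: "re_part (x + y) = re_part x + re_part (y :: 'a :: real_or_complex)"
  by (rule re_part_eqI) (simp add: of_real_re_part conjugate_dist_add add_divide_distrib)

lemma re_part_conjugate [simp]: "re_part (conjugate z) = re_part (z :: 'a :: real_or_complex)"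
  by (rule re_part_eqI) (simp add: of_real_re_part add.commute)

lemma re_part_scale: "re_part (of_real r * z) = r * re_part (z :: 'a :: real_or_complex)"
  by (rule re_part_eqI) (simp add: of_real_re_part conjugate_dist_mul algebra_simps)

lemma norm_conjugate [simp]: "norm (conjugate z) = norm (z :: 'a :: real_or_complex)"
proof (cases "z = 0")
  case False
  have "norm (z * conjugate z) = (norm z)\<^sup>2"
    unfolding mult_conjugate by (simp only: norm_of_real abs_power2 abs_norm_cancel)
  then show ?thesis using False by (simp add: norm_mult power2_eq_square)
qed simp

lemma abs_re_part_le: "\<bar>re_part z\<bar> \<le> norm (z :: 'a :: real_or_complex)"
proof -
  have "norm (of_real (re_part z) :: 'a) \<le> (norm z + norm (conjugate z)) / 2"
    unfolding of_real_re_part norm_divide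
    using norm_triangle_ineq[of z "conjugate z"] by simp
  then show ?thesis by simp
qed

lemma bounded_linear_re_part: "bounded_linear (re_part :: 'a :: real_or_complex \<Rightarrow> real)"
proof (rule bounded_linear_intro[where K = 1])
  show "re_part (r *\<^sub>R x) = r *\<^sub>R re_part x" for r and x :: 'a
    using re_part_scale[of r x] by (simp add: scaleR_conv_of_real)
qed (simp_all add: re_part_add abs_re_part_le)

lemma bounded_linear_conjugate: "bounded_linear (conjugate :: 'a :: real_or_complex \<Rightarrow> 'a)"
  by (rule bounded_linear_intro[where K = 1])
    (simp_all add: conjugate_dist_add conjugate_dist_mul scaleR_conv_of_real)

lemmas tendsto_re_part = bounded_linear.tendsto[OF bounded_linear_re_part]
lemmas tendsto_conjugate = bounded_linear.tendsto[OF bounded_linear_conjugate]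

lemma re_part_sum: "re_part (sum g I) = (\<Sum>i\<in>I. re_part (g i :: 'a :: real_or_complex))"
  by (rule linear_sum[OF bounded_linear.linear[OF bounded_linear_re_part]])

text \<open>
  This reduces convergence of scalars to convergence of real sequences.  With \<open>c = 1\<close> and \<open>c = -i\<close> the hypothesis controls both real coordinates of \<open>z\<close>.
\<close>

lemma convergent_if_re_parts_convergent:
  fixes z :: "nat \<Rightarrow> 'a :: real_or_complex"
  assumes "\<And>c. convergent (\<lambda>k. re_part (c * z k))"
  shows "convergent z"
  using real_or_complex_cases[where 'a = 'a]
proof
  assume *: "\<forall>x :: 'a. x \<in> \<real>"
  have "of_real (re_part x) = x" for x :: 'a
    using * by (metis Reals_cases re_part_of_real)
  moreover obtain l where "(\<lambda>k. re_part (1 * z k)) \<longlonglongrightarrow> l"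
    using assms[of 1] unfolding convergent_def by blast
  then have "(\<lambda>k. of_real (re_part (z k)) :: 'a) \<longlonglongrightarrow> of_real l"
    by (intro tendsto_of_real) simp
  ultimately show ?thesis unfolding convergent_def by auto
next
  assume "\<exists>i :: 'a. i\<^sup>2 = -1 \<and> conjugate i = - i \<and> (\<forall>x. \<exists>a b. x = of_real a + of_real b * i)"
  then obtain i :: 'a where i: "i * i = -1" "conjugate i = - i"
    and all: "\<And>x. \<exists>a b. x = of_real a + of_real b * i"
    by (auto simp: power2_eq_square)
  have [simp]: "re_part i = 0" by (rule re_part_eqI) (simp add: i)
  have split: "of_real (re_part x) + of_real (re_part (- i * x)) * i = x" for x
  proof -
    obtain a b where x: "x = of_real a + of_real b * i" using all by blast
    have "re_part x = a" unfolding x by (simp add: re_part_add re_part_scale)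
    moreover have "- i * x = of_real (- a) * i - of_real b * (i * i)"
      unfolding x by (simp add: algebra_simps)
    then have "- i * x = of_real b + of_real (- a) * i" by (simp add: i(1))
    then have "re_part (- i * x) = b" by (simp only: re_part_add re_part_scale) simp
    ultimately show ?thesis by (simp add: x)
  qed
  obtain l where l: "(\<lambda>k. re_part (1 * z k)) \<longlonglongrightarrow> l"
    using assms[of 1] unfolding convergent_def by blast
  obtain m where m: "(\<lambda>k. re_part (- i * z k)) \<longlonglongrightarrow> m"
    using assms[of "- i"] unfolding convergent_def by blast
  have "(\<lambda>k. of_real (re_part (1 * z k)) + of_real (re_part (- i * z k)) * i :: 'a)
      \<longlonglongrightarrow> of_real l + of_real m * i"
    by (intro tendsto_intros l m)
  then show ?thesis unfolding convergent_def using split by auto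
qed

text \<open>
  The real part of the sesquilinear product \<open>x\<^sup>H y\<close>.  It is a symmetric real bilinear form, which
  makes quadratic forms of Hermitian matrices accessible to real linear arithmetic.
\<close>

definition ip :: "'a :: real_or_complex ^ 'n \<Rightarrow> 'a ^ 'n \<Rightarrow> real" where
  "ip x y = re_part (\<Sum>i\<in>UNIV. conjugate (x $ i) * y $ i)"

lemma ip_commute: "ip x y = ip y x"
proof -
  have "conjugate (\<Sum>i\<in>UNIV. conjugate (x $ i) * y $ i) = (\<Sum>i\<in>UNIV. conjugate (y $ i) * x $ i)"
    by (simp add: sum_conjugate conjugate_dist_mul mult.commute)
  then show ?thesis unfolding ip_def by (metis re_part_conjugate)
qed

lemma ip_add_right: "ip x (y + z) = ip x y + ip x z"
  unfolding ip_def by (simp add: distrib_left sum.distrib re_part_add)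

lemma ip_scaleR_right: "ip x (r *\<^sub>R y) = r * ip x y"
proof -
  have "conjugate (x $ i) * (r *\<^sub>R y) $ i = of_real r * (conjugate (x $ i) * y $ i)" for i
    by (subst vector_scaleR_component, subst scaleR_conv_of_real, rule mult.left_commute)
  then show ?thesis unfolding ip_def re_part_scale[symmetric] by (simp only: sum_distrib_left)
qed

lemma ip_minus_right: "ip x (- y) = - ip x y"
  using ip_scaleR_right[of x "-1" y] by simp

lemma ip_diff_right: "ip x (y - z) = ip x y - ip x z"
  using ip_add_right[of x y "- z"] by (simp add: ip_minus_right)

lemma ip_add_left: "ip (x + y) z = ip x z + ip y z"
  by (metis ip_commute ip_add_right)

lemma ip_minus_left: "ip (- x) z = - ip x z"
  by (metis ip_commute ip_minus_right)

lemma ip_diff_left: "ip (x - y) z = ip x z - ip y z"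
  by (metis ip_commute ip_diff_right)

lemma ip_zero [simp]: "ip 0 y = 0" "ip x 0 = 0"
  using ip_minus_left[of 0 y] ip_minus_right[of x 0] by simp_all

lemmas ip_simps = ip_add_right ip_add_left ip_diff_right ip_diff_left ip_minus_right ip_minus_left

lemma ip_smult_both: "ip (c *s x) (c *s y) = (norm c)\<^sup>2 * ip x y"
proof -
  have "conjugate ((c *s x) $ i) * (c *s y) $ i = of_real ((norm c)\<^sup>2) * (conjugate (x $ i) * y $ i)" for i
    unfolding mult_conjugate[symmetric] by (simp add: conjugate_dist_mul mult_ac)
  then show ?thesis unfolding ip_def re_part_scale[symmetric] by (simp only: sum_distrib_left)
qed

lemma ip_adjoint: "ip (M *v x) y = ip x (M\<^sup>H *v y)"
proof -
  have "(\<Sum>i\<in>UNIV. conjugate ((M *v x) $ i) * y $ i)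
      = (\<Sum>i\<in>UNIV. \<Sum>j\<in>UNIV. conjugate (x $ j) * (conjugate (M $ i $ j) * y $ i))"
    unfolding matrix_vector_mult_def
    by (simp add: sum_conjugate conjugate_dist_mul sum_distrib_right mult.assoc)
      (simp only: mult.left_commute)
  also have "\<dots> = (\<Sum>j\<in>UNIV. conjugate (x $ j) * (M\<^sup>H *v y) $ j)"
    unfolding matrix_vector_mult_def conj_transpose_def
    by (subst sum.swap) (simp add: sum_distrib_left)
  finally show ?thesis by (simp add: ip_def)
qed

lemma tendsto_matrix_vector_mult:
  fixes M :: "nat \<Rightarrow> 'a :: real_normed_field ^ 'n ^ 'm"
  shows "M \<longlonglongrightarrow> L \<Longrightarrow> (\<lambda>k. M k *v x) \<longlonglongrightarrow> L *v x"
  unfolding matrix_vector_mult_def by (intro tendsto_intros)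

lemma tendsto_ip_right: "y \<longlonglongrightarrow> l \<Longrightarrow> (\<lambda>k. ip x (y k)) \<longlonglongrightarrow> ip x l"
  unfolding ip_def by (intro tendsto_re_part tendsto_intros)


section \<open>Conjugate transposes, inverses and Schur complements\<close>

lemma conj_transpose_nth [simp]: "M\<^sup>H $ i $ j = conjugate (M $ j $ i)"
  by (simp add: conj_transpose_def)

lemma conj_transpose_conj_transpose [simp]: "(M\<^sup>H)\<^sup>H = M"
  by (simp add: vec_eq_iff)

lemma conj_transpose_add: "(M + N)\<^sup>H = M\<^sup>H + (N\<^sup>H :: 'a :: conjugatable_ring ^ 'n ^ 'm)"
  by (simp add: vec_eq_iff conjugate_dist_add)

lemma conj_transpose_uminus: "(- M)\<^sup>H = - (M\<^sup>H :: 'a :: conjugatable_ring ^ 'n ^ 'm)"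
  by (simp add: vec_eq_iff conjugate_neg)

lemma conj_transpose_diff: "(M - N)\<^sup>H = M\<^sup>H - (N\<^sup>H :: 'a :: conjugatable_ring ^ 'n ^ 'm)"
  using conj_transpose_add[of M "- N"] by (simp add: conj_transpose_uminus)

lemma conj_transpose_mult: "(M ** N)\<^sup>H = N\<^sup>H ** (M\<^sup>H :: 'a :: real_or_complex ^ 'n ^ 'm)"
  by (simp add: vec_eq_iff matrix_matrix_mult_def sum_conjugate conjugate_dist_mul mult.commute)

lemma conj_transpose_zero [simp]: "(0 :: 'a :: conjugatable_ring ^ 'n ^ 'm)\<^sup>H = 0"
  by (simp add: vec_eq_iff)

lemma conj_transpose_mat_1 [simp]: "(mat 1 :: 'a :: real_or_complex ^ 'n ^ 'n)\<^sup>H = mat 1"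
proof -
  have "conjugate (1 :: 'a) = 1" using conjugate_of_real[of 1, where 'a = 'a] by simp
  then show ?thesis by (simp add: vec_eq_iff mat_def)
qed

lemmas conj_transpose_simps =
  conj_transpose_add conj_transpose_uminus conj_transpose_diff conj_transpose_mult

lemma matrix_add_rdistrib: "(A + B) ** C = A ** C + B ** (C :: 'a :: ring_1 ^ 'p ^ 'n)"
  by (simp add: vec_eq_iff matrix_matrix_mult_def distrib_right sum.distrib)

lemma matrix_diff_rdistrib: "(A - B) ** C = A ** C - B ** (C :: 'a :: ring_1 ^ 'p ^ 'n)"
  by (simp add: vec_eq_iff matrix_matrix_mult_def left_diff_distrib sum_subtractf)

lemma matrix_diff_ldistrib: "C ** (A - B) = C ** A - C ** (B :: 'a :: ring_1 ^ 'p ^ 'n)"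
  by (simp add: vec_eq_iff matrix_matrix_mult_def right_diff_distrib sum_subtractf)

lemma matrix_minus_right: "C ** (- B) = - (C ** (B :: 'a :: ring_1 ^ 'p ^ 'n))"
  using matrix_diff_ldistrib[of C 0 B] by simp

lemma matrix_minus_left: "(- B) ** C = - (B ** (C :: 'a :: ring_1 ^ 'p ^ 'n))"
  using matrix_diff_rdistrib[of 0 B C] by simp

lemma matrix_minus_vector: "(- M) *v x = - (M *v (x :: 'a :: ring_1 ^ 'n))"
  using matrix_vector_mult_diff_rdistrib[of 0 M x] by simp

lemmas matrix_ring_simps = matrix_add_ldistrib matrix_add_rdistrib matrix_diff_rdistrib
  matrix_diff_ldistrib matrix_minus_right matrix_minus_left matrix_mul_assoc

lemma matrix_inv_mult:
  fixes M :: "'a :: field ^ 'n ^ 'n"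
  assumes "invertible M"
  shows "M ** matrix_inv M = mat 1" "matrix_inv M ** M = mat 1"
  using someI_ex[OF assms[unfolded invertible_def]] by (auto simp: matrix_inv_def)

lemma matrix_inv_unique_right:
  fixes M N :: "'a :: field ^ 'n ^ 'n"
  assumes "M ** N = mat 1"
  shows "invertible M" "matrix_inv M = N"
proof -
  show inv: "invertible M"
    using assms matrix_left_right_inverse by (auto simp: invertible_def)
  have "matrix_inv M = matrix_inv M ** (M ** N)" by (simp add: assms)
  then show "matrix_inv M = N" by (simp add: matrix_mul_assoc matrix_inv_mult[OF inv])
qed

lemma invertible_matrix_inv:
  fixes M :: "'a :: field ^ 'n ^ 'n"
  assumes "invertible M"
  shows "invertible (matrix_inv M)" "matrix_inv (matrix_inv M) = M"
  using matrix_inv_unique_right[OF matrix_inv_mult(2)[OF assms]] by auto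

lemma matrix_inv_product:
  fixes M N :: "'a :: field ^ 'n ^ 'n"
  assumes "invertible M" "invertible N"
  shows "matrix_inv (M ** N) = matrix_inv N ** matrix_inv M"
proof (rule matrix_inv_unique_right(2))
  have "M ** N ** (matrix_inv N ** matrix_inv M) = M ** (N ** matrix_inv N) ** matrix_inv M"
    by (simp add: matrix_mul_assoc)
  then show "M ** N ** (matrix_inv N ** matrix_inv M) = mat 1"
    by (simp add: matrix_inv_mult assms)
qed

lemma conj_transpose_inv:
  fixes M :: "'a :: real_or_complex ^ 'n ^ 'n"
  assumes "invertible M"
  shows "invertible (M\<^sup>H)" "matrix_inv (M\<^sup>H) = (matrix_inv M)\<^sup>H"
proof -
  have "M\<^sup>H ** (matrix_inv M)\<^sup>H = mat 1"
    unfolding conj_transpose_mult[symmetric] by (simp add: matrix_inv_mult assms)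
  from matrix_inv_unique_right[OF this]
  show "invertible (M\<^sup>H)" "matrix_inv (M\<^sup>H) = (matrix_inv M)\<^sup>H" by auto
qed

lemma hermitian_matrix_inv:
  fixes M :: "'a :: real_or_complex ^ 'n ^ 'n"
  shows "hermitian M \<Longrightarrow> invertible M \<Longrightarrow> hermitian (matrix_inv M)"
  unfolding hermitian_def using conj_transpose_inv by metis

text \<open>
  The Woodbury identity.  If one Schur complement of the block matrix with diagonal \<open>P, R\<close> and
  off-diagonal \<open>U, V\<close> is invertible, then so is the other one.  Exchanging the roles of \<open>(P, U)\<close> and \<open>(R, V)\<close> therefore expresses either inverse through the other.
\<close>

lemma schur_complement_inverse:
  fixes P R U V :: "'a :: field ^ 'n ^ 'n"
  assumes P: "invertible P" and R: "invertible R"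
    and S: "invertible (P - U ** matrix_inv R ** V)"
  defines "T \<equiv> R - V ** matrix_inv P ** U"
  shows "invertible T"
    and "matrix_inv T = matrix_inv R
      + matrix_inv R ** V ** matrix_inv (P - U ** matrix_inv R ** V) ** U ** matrix_inv R"
proof -
  define S' where "S' = P - U ** matrix_inv R ** V"
  define W where "W = V ** matrix_inv S' ** U ** matrix_inv R"
  let ?N = "matrix_inv R + matrix_inv R ** W"
  have "T ** ?N = R ** matrix_inv R + R ** matrix_inv R ** W
      - V ** matrix_inv P ** U ** matrix_inv R
      - V ** matrix_inv P ** (U ** matrix_inv R ** V) ** matrix_inv S' ** U ** matrix_inv R"
    unfolding T_def W_def by (simp add: matrix_ring_simps)
  also have "U ** matrix_inv R ** V = P - S'" by (simp add: S'_def)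
  also have "V ** matrix_inv P ** (P - S') ** matrix_inv S' ** U ** matrix_inv R
      = V ** (matrix_inv P ** P) ** matrix_inv S' ** U ** matrix_inv R
        - V ** matrix_inv P ** (S' ** matrix_inv S') ** U ** matrix_inv R"
    by (simp add: matrix_ring_simps)
  also have "R ** matrix_inv R + R ** matrix_inv R ** W - V ** matrix_inv P ** U ** matrix_inv R
      - \<dots> = mat 1"
    using S by (simp add: matrix_inv_mult P R W_def S'_def[symmetric])
  finally have "T ** ?N = mat 1" .
  from matrix_inv_unique_right[OF this] show "invertible T"
    "matrix_inv T = matrix_inv R
      + matrix_inv R ** V ** matrix_inv (P - U ** matrix_inv R ** V) ** U ** matrix_inv R"
    by (simp_all add: W_def S'_def matrix_mul_assoc)
qed


section \<open>The Loewner order\<close>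

lemma hermitian_simps:
  "hermitian (0 :: 'a :: real_or_complex ^ 'n ^ 'n)"
  "hermitian (mat 1 :: 'a :: real_or_complex ^ 'n ^ 'n)"
  "hermitian M \<Longrightarrow> hermitian N \<Longrightarrow> hermitian (M + N :: 'a :: real_or_complex ^ 'n ^ 'n)"
  "hermitian M \<Longrightarrow> hermitian N \<Longrightarrow> hermitian (M - N :: 'a :: real_or_complex ^ 'n ^ 'n)"
  "hermitian M \<Longrightarrow> hermitian (- M :: 'a :: real_or_complex ^ 'n ^ 'n)"
  by (simp_all add: hermitian_def conj_transpose_simps)

lemma hermitian_congruence:
  "hermitian M \<Longrightarrow> hermitian (C\<^sup>H ** M ** (C :: 'a :: real_or_complex ^ 'm ^ 'n))"
  by (simp add: hermitian_def conj_transpose_simps matrix_mul_assoc)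

lemma ip_hermitian: "hermitian M \<Longrightarrow> ip (M *v x) y = ip x (M *v y)"
  by (simp add: ip_adjoint hermitian_def)

lemma ip_congruence: "ip x ((C\<^sup>H ** M ** C) *v y) = ip (C *v x) (M *v (C *v y))"
  unfolding ip_adjoint by (simp add: matrix_vector_mul_assoc matrix_mul_assoc)

text \<open>
  For Hermitian \<open>M\<close> the scalar \<open>x\<^sup>H M x\<close> equals its own conjugate, so passing to its real part
  loses nothing.
\<close>

lemma quad_form_hermitian:
  assumes "hermitian M"
  shows "quad_form M x = of_real (ip x (M *v x))"
proof -
  have M: "conjugate (M $ i $ j) = M $ j $ i" for i j
    using assms conj_transpose_nth[of M j i] by (simp add: hermitian_def)
  have expand: "quad_form M x = (\<Sum>i\<in>UNIV. \<Sum>j\<in>UNIV. conjugate (x $ i) * (M $ i $ j * x $ j))"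
    by (simp add: quad_form_def matrix_vector_mult_def sum_distrib_left)
  have "conjugate (quad_form M x)
      = (\<Sum>i\<in>UNIV. \<Sum>j\<in>UNIV. conjugate (x $ j) * (M $ j $ i * x $ i))"
    unfolding expand by (simp add: sum_conjugate conjugate_dist_mul M mult_ac)
  also have "\<dots> = quad_form M x" unfolding expand by (rule sum.swap)
  finally have "of_real (re_part (quad_form M x)) = quad_form M x"
    by (rule of_real_re_part_fixed)
  then show ?thesis by (simp add: quad_form_def ip_def)
qed

lemma pos_semidef_iff: "pos_semidef M \<longleftrightarrow> hermitian M \<and> (\<forall>x. 0 \<le> ip x (M *v x))"
  unfolding pos_semidef_def by (simp add: quad_form_hermitian cong: conj_cong)

lemma pos_def_iff: "pos_def M \<longleftrightarrow> hermitian M \<and> (\<forall>x. x \<noteq> 0 \<longrightarrow> 0 < ip x (M *v x))"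
  unfolding pos_def_def by (simp add: quad_form_hermitian cong: conj_cong)

lemma pos_def_hermitian: "pos_def M \<Longrightarrow> hermitian M"
  by (simp add: pos_def_iff)

lemma pos_semidef_hermitian: "pos_semidef M \<Longrightarrow> hermitian M"
  by (simp add: pos_semidef_iff)

lemma pos_def_imp_pos_semidef: "pos_def M \<Longrightarrow> pos_semidef M"
  unfolding pos_def_iff pos_semidef_iff
proof (elim conjE, intro conjI allI)
  fix x
  assume "\<forall>x. x \<noteq> 0 \<longrightarrow> 0 < ip x (M *v x)"
  then show "0 \<le> ip x (M *v x)" by (cases "x = 0") (auto simp: less_imp_le)
qed

lemma pos_semidef_add: "pos_semidef M \<Longrightarrow> pos_semidef N \<Longrightarrow> pos_semidef (M + N)"
  by (simp add: pos_semidef_iff hermitian_simps matrix_vector_mult_add_rdistrib ip_simps)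

lemma pos_def_add_pos_semidef: "pos_def M \<Longrightarrow> pos_semidef N \<Longrightarrow> pos_def (M + N)"
  by (simp add: pos_semidef_iff pos_def_iff hermitian_simps matrix_vector_mult_add_rdistrib ip_simps
      add_pos_nonneg)

lemma pos_semidef_congruence: "pos_semidef M \<Longrightarrow> pos_semidef (C\<^sup>H ** M ** C)"
  by (simp add: pos_semidef_iff hermitian_congruence ip_congruence)

lemma pos_def_ker: "pos_def M \<Longrightarrow> M *v x = 0 \<Longrightarrow> x = 0"
  unfolding pos_def_iff by (cases "x = 0") auto

lemma pos_def_invertible: "pos_def M \<Longrightarrow> invertible M"
  unfolding invertible_left_inverse matrix_left_invertible_ker using pos_def_ker by blast

lemma invertible_ker: "invertible (M :: 'a :: field ^ 'n ^ 'n) \<Longrightarrow> M *v x = 0 \<Longrightarrow> x = 0"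
  unfolding invertible_left_inverse matrix_left_invertible_ker by blast

lemma pos_def_congruence:
  fixes C :: "'a :: real_or_complex ^ 'n ^ 'n"
  shows "pos_def M \<Longrightarrow> invertible C \<Longrightarrow> pos_def (C\<^sup>H ** M ** C)"
  using invertible_ker[of C] by (auto simp: pos_def_iff hermitian_congruence ip_congruence)

lemma pos_def_matrix_inv:
  assumes "pos_def M"
  shows "pos_def (matrix_inv M)"
proof -
  have inv: "invertible M" and h: "hermitian M"
    using assms by (simp_all add: pos_def_invertible pos_def_hermitian)
  have "matrix_inv M = (matrix_inv M)\<^sup>H ** M ** matrix_inv M"
    using hermitian_matrix_inv[OF h inv] matrix_inv_mult[OF inv] by (simp add: hermitian_def)
  then show ?thesis
    using pos_def_congruence[OF assms invertible_matrix_inv(1)[OF inv]] by simp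
qed

lemma loewner_le_refl [simp]: "X \<preceq> X"
  by (simp add: loewner_le_def pos_semidef_iff hermitian_simps)

lemma loewner_le_trans [trans]: "X \<preceq> Y \<Longrightarrow> Y \<preceq> Z \<Longrightarrow> X \<preceq> Z"
  using pos_semidef_add[of "Y - X" "Z - Y"] by (simp add: loewner_le_def)

lemma pos_def_loewner_le: "pos_def X \<Longrightarrow> X \<preceq> Y \<Longrightarrow> pos_def Y"
  using pos_def_add_pos_semidef[of X "Y - X"] by (simp add: loewner_le_def)

lemma loewner_le_imp_ip_le: "X \<preceq> Y \<Longrightarrow> ip x (X *v x) \<le> ip x (Y *v x)"
  by (simp add: loewner_le_def pos_semidef_iff matrix_vector_mult_diff_rdistrib ip_simps)

lemma loewner_leI:
  assumes "hermitian X" "hermitian Y" "\<And>x. ip x (X *v x) \<le> ip x (Y *v x)"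
  shows "X \<preceq> Y"
  using assms by (simp add: loewner_le_def pos_semidef_iff matrix_vector_mult_diff_rdistrib
      ip_simps hermitian_simps)

lemma loewner_le_congruence: "X \<preceq> Y \<Longrightarrow> C\<^sup>H ** X ** C \<preceq> C\<^sup>H ** Y ** C"
  using pos_semidef_congruence[of "Y - X" C] by (simp add: loewner_le_def matrix_ring_simps)

lemma loewner_le_diff_left: "X \<preceq> Y \<Longrightarrow> Q - Y \<preceq> Q - X"
  by (simp add: loewner_le_def)

text \<open>
  Completing the square in \<open>v\<close>.  This identity is used twice: to show that inversion reverses the
  Loewner order, and to evaluate the telescoping sums for the matrix equation.
\<close>

lemma ip_complete_square:
  assumes "hermitian M" "invertible M"
  shows "ip (v + matrix_inv M *v (C *v u)) (M *v (v + matrix_inv M *v (C *v u)))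
    = ip v (M *v v) + 2 * ip v (C *v u) + ip u ((C\<^sup>H ** matrix_inv M ** C) *v u)"
proof -
  have cancel: "M *v (matrix_inv M *v y) = y" for y
    by (simp add: matrix_vector_mul_assoc matrix_inv_mult assms)
  have "ip (matrix_inv M *v (C *v u)) (M *v v) = ip v (C *v u)"
    by (simp only: ip_hermitian[OF assms(1), symmetric] cancel ip_commute[of v])
  moreover have "ip (matrix_inv M *v (C *v u)) (C *v u) = ip u ((C\<^sup>H ** matrix_inv M ** C) *v u)"
    by (simp add: ip_congruence ip_commute)
  ultimately show ?thesis
    by (simp add: matrix_vector_right_distrib cancel ip_simps)
qed

text \<open>
  The value \<open>x\<^sup>H M\<^sup>-\<^sup>1 x\<close> is the maximum over \<open>y\<close> of \<open>- (y\<^sup>H M y + 2 Re y\<^sup>H x)\<close>, and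
  that expression decreases when \<open>M\<close> grows.  The proof compares the two maxima at the maximiser
  \<open>y = - N\<^sup>-\<^sup>1 x\<close> for the larger matrix.
\<close>

lemma loewner_matrix_inv_antimono:
  assumes M: "pos_def M" and MN: "M \<preceq> N"
  shows "matrix_inv N \<preceq> matrix_inv M"
proof (rule loewner_leI)
  have N: "pos_def N" by (rule pos_def_loewner_le[OF M MN])
  note inv = pos_def_invertible[OF M] pos_def_invertible[OF N]
  note herm = pos_def_hermitian[OF M] pos_def_hermitian[OF N]
  show "hermitian (matrix_inv N)" "hermitian (matrix_inv M)"
    by (rule hermitian_matrix_inv herm inv)+
  fix x
  define y where "y = - (matrix_inv N *v x)"
  have "matrix_inv N *v x = - y" by (simp add: y_def)
  moreover have "N *v y = - x"
    using vec.neg[of N "matrix_inv N *v x"]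
    by (simp add: y_def matrix_vector_mul_assoc matrix_inv_mult inv)
  ultimately have "ip x (matrix_inv N *v x) = - (ip y (N *v y) + 2 * ip y x)"
    by (simp add: ip_simps ip_commute[of x y])
  also have "\<dots> \<le> - (ip y (M *v y) + 2 * ip y x)"
    using loewner_le_imp_ip_le[OF MN, of y] by simp
  also have "\<dots> \<le> ip x (matrix_inv M *v x)"
  proof -
    have "0 \<le> ip (y + matrix_inv M *v (mat 1 *v x)) (M *v (y + matrix_inv M *v (mat 1 *v x)))"
      using pos_def_imp_pos_semidef[OF M] by (simp add: pos_semidef_iff)
    then have "0 \<le> ip y (M *v y) + 2 * ip y (mat 1 *v x)
        + ip x (((mat 1)\<^sup>H ** matrix_inv M ** mat 1) *v x)"
      by (simp only: ip_complete_square[OF herm(1) inv(1)])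
    then show ?thesis by simp
  qed
  finally show "ip x (matrix_inv N *v x) \<le> ip x (matrix_inv M *v x)" .
qed


section \<open>Limits in the Loewner order\<close>

lemma tendsto_matrix_mult:
  fixes M :: "nat \<Rightarrow> 'a :: real_normed_field ^ 'n ^ 'm" and N :: "nat \<Rightarrow> 'a ^ 'p ^ 'n"
  shows "M \<longlonglongrightarrow> K \<Longrightarrow> N \<longlonglongrightarrow> L \<Longrightarrow> (\<lambda>k. M k ** N k) \<longlonglongrightarrow> K ** L"
  unfolding matrix_matrix_mult_def by (intro tendsto_intros)

lemma tendsto_conj_transpose:
  "(M :: nat \<Rightarrow> 'a :: real_or_complex ^ 'n ^ 'm) \<longlonglongrightarrow> L \<Longrightarrow> (\<lambda>k. (M k)\<^sup>H) \<longlonglongrightarrow> L\<^sup>H"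
  unfolding conj_transpose_def by (intro tendsto_intros tendsto_conjugate)

lemma pos_semidef_limit:
  assumes lim: "M \<longlonglongrightarrow> L" and M: "\<And>k. pos_semidef (M k)"
  shows "pos_semidef L"
  unfolding pos_semidef_iff
proof
  have "(M k)\<^sup>H = M k" for k
    using M[of k] by (simp add: pos_semidef_iff hermitian_def)
  with tendsto_conj_transpose[OF lim] have "M \<longlonglongrightarrow> L\<^sup>H" by simp
  then show "hermitian L"
    unfolding hermitian_def by (rule LIMSEQ_unique[OF _ lim])
  have "0 \<le> ip x (L *v x)" for x
    by (rule LIMSEQ_le_const[OF tendsto_ip_right[OF tendsto_matrix_vector_mult[OF lim]]])
      (use M in \<open>simp add: pos_semidef_iff\<close>)
  then show "\<forall>x. 0 \<le> ip x (L *v x)" ..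
qed

lemma loewner_le_limit:
  assumes "M \<longlonglongrightarrow> L" "\<And>k. Y \<preceq> M k"
  shows "Y \<preceq> L"
  unfolding loewner_le_def
  by (rule pos_semidef_limit[OF tendsto_diff[OF assms(1) tendsto_const]])
    (rule assms(2)[unfolded loewner_le_def])

text \<open>
  Every diagonal value \<open>x\<^sup>H M\<^sub>k x\<close> is a bounded monotone real sequence.  Polarisation extends the
  convergence to all real parts \<open>Re x\<^sup>H M\<^sub>k y\<close>, and these determine the entries.
\<close>

lemma loewner_decreasing_convergent:
  fixes M :: "nat \<Rightarrow> 'a :: real_or_complex ^ 'n ^ 'n"
  assumes herm: "\<And>k. hermitian (M k)"
    and dec: "\<And>k. M (Suc k) \<preceq> M k" and bound: "\<And>k. Y \<preceq> M k"
  shows "convergent M"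
proof -
  have diagonal: "convergent (\<lambda>k. ip x (M k *v x))" for x
  proof -
    have "decseq (\<lambda>k. ip x (M k *v x))"
      unfolding decseq_Suc_iff using loewner_le_imp_ip_le[OF dec] by blast
    moreover have "\<forall>k. ip x (Y *v x) \<le> ip x (M k *v x)"
      using loewner_le_imp_ip_le[OF bound] by blast
    ultimately show ?thesis
      by (metis decseq_convergent convergentI)
  qed
  have polar: "ip x (M k *v y)
      = (ip (x + y) (M k *v (x + y)) - ip x (M k *v x) - ip y (M k *v y)) / 2" for x y k
    using ip_hermitian[OF herm, of k y x] ip_commute[of "M k *v y" x]
    by (simp add: matrix_vector_right_distrib ip_simps)
  have form: "convergent (\<lambda>k. ip x (M k *v y))" for x y
  proof -
    obtain l1 l2 l3 where "(\<lambda>k. ip (x + y) (M k *v (x + y))) \<longlonglongrightarrow> l1"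
      "(\<lambda>k. ip x (M k *v x)) \<longlonglongrightarrow> l2" "(\<lambda>k. ip y (M k *v y)) \<longlonglongrightarrow> l3"
      using diagonal unfolding convergent_def by metis
    then have "(\<lambda>k. (ip (x + y) (M k *v (x + y)) - ip x (M k *v x) - ip y (M k *v y)) / 2)
        \<longlonglongrightarrow> (l1 - l2 - l3) / 2"
      by (intro tendsto_intros) auto
    then have "(\<lambda>k. ip x (M k *v y)) \<longlonglongrightarrow> (l1 - l2 - l3) / 2"
      by (simp only: polar[symmetric])
    then show ?thesis by (rule convergentI)
  qed
  have entry: "re_part (c * M k $ i $ j) = ip (axis i (conjugate c)) (M k *v axis j 1)" for c i j k
  proof -
    have col: "(M k *v axis j 1) $ l = M k $ l $ j" for l
      by (simp add: matrix_vector_mult_def axis_def if_distrib cong: if_cong)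
    have "conjugate (axis i (conjugate c) $ l) * M k $ l $ j = (if l = i then c * M k $ i $ j else 0)" for l
      by (simp add: axis_def)
    then show ?thesis unfolding ip_def col by simp
  qed
  have "convergent (\<lambda>k. M k $ i $ j)" for i j
    by (rule convergent_if_re_parts_convergent) (simp only: entry form)
  then obtain L where "(\<lambda>k. M k $ i $ j) \<longlonglongrightarrow> L i j" for i j
    unfolding convergent_def by metis
  then have "M \<longlonglongrightarrow> (\<chi> i j. L i j)"
    by (intro vec_tendstoI) simp
  then show ?thesis by (rule convergentI)
qed


section \<open>Hermitian solutions are positive definite\<close>

text \<open>
  More vectors than the dimension are dependent.  The coefficient of the last vector is nonzero
  because \<open>N\<close> is taken to be the first index where \<open>g N\<close> is spanned by its predecessors.
\<close>

lemma exists_annihilating_combination: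
  fixes g :: "nat \<Rightarrow> 'a :: field ^ 'n"
  obtains N a where "a N \<noteq> 0" "(\<Sum>k\<le>N. a k *s g k) = 0"
proof -
  have "\<exists>N. g N \<in> vec.span (g ` {..<N}) \<and> inj_on g {..<N}"
  proof (rule ccontr)
    assume none: "\<not> ?thesis"
    have "inj_on g {..<N} \<and> vec.independent (g ` {..<N})" for N
    proof (induction N)
      case (Suc N)
      then have notin: "g N \<notin> vec.span (g ` {..<N})" using none by blast
      have "g N \<notin> g ` {..<N}"
      proof
        assume "g N \<in> g ` {..<N}"
        then have "g N \<in> vec.span (g ` {..<N})" by (rule vec.span_base)
        with notin show False ..
      qed
      then show ?case using Suc notin
        by (simp add: lessThan_Suc vec.independent_insert)
    qed (simp add: vec.independent_empty)
    from this[of "Suc CARD('n)"] have "card (g ` {..<Suc CARD('n)}) = Suc CARD('n)"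
      and "card (g ` {..<Suc CARD('n)}) \<le> vec.dim (g ` {..<Suc CARD('n)})"
      by (auto simp: card_image vec.dim_eq_card_independent)
    moreover have "vec.dim (g ` {..<Suc CARD('n)}) \<le> CARD('n)"
      using vec.dim_subset_UNIV[of "g ` {..<Suc CARD('n)}"]
      unfolding vec.dimension_def card_cart_basis .
    ultimately show False by simp
  qed
  then obtain N where N: "g N \<in> vec.span (g ` {..<N})" "inj_on g {..<N}" by blast
  then obtain u where u: "g N = (\<Sum>v\<in>g ` {..<N}. u v *s v)"
    using vec.span_finite[of "g ` {..<N}"] by auto
  define a where "a k = (if k = N then 1 else - u (g k))" for k
  have "(\<Sum>k\<le>N. a k *s g k) = g N + (\<Sum>k<N. - u (g k) *s g k)"
    by (simp add: lessThan_Suc_atMost[symmetric] a_def)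
  also have "(\<Sum>k<N. - u (g k) *s g k) = - (\<Sum>k<N. u (g k) *s g k)"
    by (simp add: sum_negf[symmetric] vector_smult_lneg)
  also have "(\<Sum>k<N. u (g k) *s g k) = g N"
    unfolding u by (simp add: sum.reindex[OF N(2)])
  finally show ?thesis by (intro that[of a N]) (simp_all add: a_def)
qed

text \<open>
  By completing squares, the sum depends on \<open>Z\<close> only through \<open>Z + C\<^sup>H Z\<^sup>-\<^sup>1 C\<close>: the remaining terms
  \<open>v\<^sub>k\<^sup>H Z v\<^sub>k\<close> cancel telescopically, and \<open>v\<close> vanishes at both ends.  Two different matrices
  with comparable values of that expression can thus be compared along the same sequence \<open>v\<close>.
\<close>

lemma sum_squares_telescope:
  fixes C Z :: "'a :: real_or_complex ^ 'n ^ 'n"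
  assumes Z: "hermitian Z" "invertible Z" and v: "v 0 = 0" "v (Suc N) = 0"
  shows "(\<Sum>k\<le>N. ip (v k + matrix_inv Z *v (C *v v (Suc k)))
                    (Z *v (v k + matrix_inv Z *v (C *v v (Suc k)))))
    = (\<Sum>k\<le>N. 2 * ip (v k) (C *v v (Suc k))
        + ip (v (Suc k)) ((Z + C\<^sup>H ** matrix_inv Z ** C) *v v (Suc k)))"
proof -
  let ?q = "\<lambda>k. ip (v k) (Z *v v k)"
  have "(\<Sum>k\<le>N. ip (v k + matrix_inv Z *v (C *v v (Suc k)))
                    (Z *v (v k + matrix_inv Z *v (C *v v (Suc k)))))
    = (\<Sum>k\<le>N. (2 * ip (v k) (C *v v (Suc k))
        + ip (v (Suc k)) ((Z + C\<^sup>H ** matrix_inv Z ** C) *v v (Suc k))) + (?q k - ?q (Suc k)))"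
    unfolding ip_complete_square[OF Z]
    by (rule sum.cong) (simp_all add: matrix_vector_mult_add_rdistrib ip_simps)
  also have "\<dots> = (\<Sum>k\<le>N. 2 * ip (v k) (C *v v (Suc k))
        + ip (v (Suc k)) ((Z + C\<^sup>H ** matrix_inv Z ** C) *v v (Suc k))) + (?q 0 - ?q (Suc N))"
    using sum_telescope[of ?q N] by (simp only: sum.distrib)
  finally show ?thesis by (simp only: v ip_zero diff_zero add_0_right)
qed

text \<open>
  Given \<open>w \<noteq> 0\<close>, a sequence \<open>v\<close> vanishing at both ends is chosen such that the squares built from
  the possibly indefinite \<open>W\<close> are \<open>|a\<^sub>k|\<^sup>2 w\<^sup>H W w\<close>.  Their sum is at least the sum of the squares
  built from the positive definite \<open>Z\<close>, which is positive.  Hence \<open>w\<^sup>H W w > 0\<close>.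

  The recursion \<open>v\<^sub>k = a\<^sub>k w + R v\<^sub>k\<^sub>+\<^sub>1\<close> with \<open>R = - W\<^sup>-\<^sup>1 C\<close> forces the squares to have this
  form, and starting from \<open>v\<^sub>N\<^sub>+\<^sub>1 = 0\<close> it leads to \<open>v\<^sub>0 = p(R) w\<close> for the polynomial \<open>p\<close> with coefficients \<open>a\<close>.
  So \<open>a\<close> must be a polynomial for which \<open>p(R)\<close> annihilates \<open>w\<close>.
\<close>

lemma hermitian_solution_pos_def:
  fixes W Z C :: "'a :: real_or_complex ^ 'n ^ 'n"
  assumes W: "hermitian W" "invertible W" and Z: "pos_def Z"
    and le: "Z + C\<^sup>H ** matrix_inv Z ** C \<preceq> W + C\<^sup>H ** matrix_inv W ** C"
  shows "pos_def W"
proof -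
  have "0 < ip w (W *v w)" if w: "w \<noteq> 0" for w
  proof -
    define R where "R = - (matrix_inv W ** C)"
    define g where "g k = ((*v) R ^^ k) w" for k
    obtain N a where aN: "a N \<noteq> 0" and comb: "(\<Sum>k\<le>N. a k *s g k) = 0"
      by (rule exists_annihilating_combination)
    define v where "v k = (\<Sum>j\<in>{k..N}. a j *s g (j - k))" for k
    have v0: "v 0 = 0" using comb by (simp add: v_def atMost_atLeast0)
    have vN: "v (Suc N) = 0" by (simp add: v_def)
    have rec: "v k + matrix_inv W *v (C *v v (Suc k)) = a k *s w" if "k \<le> N" for k
    proof -
      have "g (j - k) = R *v g (j - Suc k)" if "j \<in> {Suc k..N}" for j
      proof -
        have "j - k = Suc (j - Suc k)" using that by auto
        then show ?thesis by (simp add: g_def)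
      qed
      then have "R *v v (Suc k) = (\<Sum>j\<in>{Suc k..N}. a j *s g (j - k))"
        by (simp add: v_def vec.sum vec.scale)
      moreover have "v k = a k *s w + (\<Sum>j\<in>{Suc k..N}. a j *s g (j - k))"
        using that by (simp add: v_def sum.atLeast_Suc_atMost g_def)
      moreover have "matrix_inv W *v (C *v v (Suc k)) = - (R *v v (Suc k))"
        by (simp add: R_def matrix_minus_vector matrix_vector_mul_assoc)
      ultimately show ?thesis by simp
    qed
    note Zh = pos_def_hermitian[OF Z] and Zi = pos_def_invertible[OF Z]
    define z where "z k = v k + matrix_inv Z *v (C *v v (Suc k))" for k
    have "v N = a N *s w" using rec[of N] by (simp add: vN)
    then have "z N \<noteq> 0" using aN w by (simp add: z_def vN)
    then have "0 < ip (z N) (Z *v z N)" using Z by (simp add: pos_def_iff)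
    also have "\<dots> \<le> (\<Sum>k\<le>N. ip (z k) (Z *v z k))"
      using pos_def_imp_pos_semidef[OF Z]
      by (intro member_le_sum) (auto simp: pos_semidef_iff)
    also have "\<dots> = (\<Sum>k\<le>N. 2 * ip (v k) (C *v v (Suc k))
        + ip (v (Suc k)) ((Z + C\<^sup>H ** matrix_inv Z ** C) *v v (Suc k)))"
      unfolding z_def by (rule sum_squares_telescope[OF Zh Zi v0 vN])
    also have "\<dots> \<le> (\<Sum>k\<le>N. 2 * ip (v k) (C *v v (Suc k))
        + ip (v (Suc k)) ((W + C\<^sup>H ** matrix_inv W ** C) *v v (Suc k)))"
      by (intro sum_mono add_left_mono loewner_le_imp_ip_le le)
    also have "\<dots> = (\<Sum>k\<le>N. ip (v k + matrix_inv W *v (C *v v (Suc k)))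
                    (W *v (v k + matrix_inv W *v (C *v v (Suc k)))))"
      by (rule sum_squares_telescope[OF W v0 vN, symmetric])
    also have "\<dots> = (\<Sum>k\<le>N. (norm (a k))\<^sup>2 * ip w (W *v w))"
      by (rule sum.cong) (simp_all add: rec vec.scale ip_smult_both)
    also have "\<dots> = (\<Sum>k\<le>N. (norm (a k))\<^sup>2) * ip w (W *v w)"
      by (simp add: sum_distrib_right)
    finally show ?thesis
      using sum_nonneg[of "{..N}" "\<lambda>k. (norm (a k))\<^sup>2"] by (simp add: zero_less_mult_iff)
  qed
  then show ?thesis using W(1) by (simp add: pos_def_iff)
qed


section \<open>Involutive automorphisms preserving the Loewner order\<close>

text \<open>
  Testing with the diagonal unit matrix at \<open>k\<close> shows that \<open>D\<close> is diagonal; testing with the matrix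
  that exchanges the basis vectors \<open>k\<close> and \<open>l\<close> and kills the others shows that the diagonal is constant.
\<close>

lemma commutes_with_hermitian_imp_scalar:
  fixes D :: "'a :: real_or_complex ^ 'n ^ 'n"
  assumes "\<And>S. hermitian S \<Longrightarrow> D ** S = S ** D"
  obtains c where "D = mat c"
proof -
  have one: "conjugate (1 :: 'a) = 1" using conjugate_of_real[of 1, where 'a = 'a] by simp
  have off: "D $ i $ k = 0" if "i \<noteq> k" for i k
  proof -
    define E :: "'a ^ 'n ^ 'n" where "E = (\<chi> i j. if i = k \<and> j = k then 1 else 0)"
    have "hermitian E" by (simp add: hermitian_def vec_eq_iff E_def one)
    then have "(D ** E) $ i $ k = (E ** D) $ i $ k" by (simp add: assms)
    moreover have "E $ m $ k = (if m = k then 1 else 0)" "E $ i $ m = 0" for m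
      using that by (simp_all add: E_def)
    then have "(D ** E) $ i $ k = D $ i $ k" "(E ** D) $ i $ k = 0"
      by (simp_all add: matrix_matrix_mult_def mult_delta_right)
    ultimately show ?thesis by simp
  qed
  have diag: "D $ k $ k = D $ l $ l" if "k \<noteq> l" for k l
  proof -
    define E :: "'a ^ 'n ^ 'n" where
      "E = (\<chi> i j. if i = k \<and> j = l \<or> i = l \<and> j = k then 1 else 0)"
    have "hermitian E" by (auto simp: hermitian_def vec_eq_iff E_def one)
    then have "(D ** E) $ k $ l = (E ** D) $ k $ l" by (simp add: assms)
    moreover have "E $ m $ l = (if m = k then 1 else 0)" "E $ k $ m = (if m = l then 1 else 0)" for m
      using that by (auto simp: E_def)
    then have "(D ** E) $ k $ l = D $ k $ k" "(E ** D) $ k $ l = D $ l $ l"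
      by (simp_all add: matrix_matrix_mult_def mult_delta_right mult_delta_left)
    ultimately show ?thesis by simp
  qed
  have "D = mat (D $ k $ k)" for k
  proof -
    have "D $ i $ j = mat (D $ k $ k) $ i $ j" for i j
    proof (cases "i = j")
      case True
      have "D $ j $ j = D $ k $ k" by (cases "j = k") (simp, rule diag)
      with True show ?thesis by (simp add: mat_def)
    next
      case False
      then show ?thesis by (simp add: mat_def off)
    qed
    then show ?thesis unfolding vec_eq_iff by blast
  qed
  then show ?thesis by (rule that)
qed

lemma double_matrix_cancel: "M + M = N + N \<longleftrightarrow> M = (N :: 'a :: field_char_0 ^ 'n ^ 'm)"
proof -
  have "x + x = y + y \<longleftrightarrow> x = y" for x y :: 'a
    unfolding mult_2[symmetric] by simp
  then show ?thesis by (simp add: vec_eq_iff)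
qed

lemma matrix_eq_uminus_iff: "M = - M \<longleftrightarrow> M = (0 :: 'a :: field_char_0 ^ 'n ^ 'm)"
proof -
  have "M = - M \<longleftrightarrow> M + M = 0 + 0" by (simp only: eq_neg_iff_add_eq_0 add_0)
  then show ?thesis unfolding double_matrix_cancel .
qed

lemma mat_scalar_mult: "mat c ** M = (\<chi> i j. c * M $ i $ j)" "M ** mat c = (\<chi> i j. c * (M $ i $ j :: 'a :: comm_ring_1))"
  by (simp_all add: vec_eq_iff matrix_matrix_mult_def mat_def mult_delta_right mult_delta_left mult.commute)

locale loewner_involution =
  fixes f :: "'a :: real_or_complex ^ 'n ^ 'n \<Rightarrow> 'a ^ 'n ^ 'n"
  assumes f_f [simp]: "f (f M) = M"
    and f_add: "f (M + N) = f M + f N"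
    and f_mult: "f (M ** N) = f M ** f N"
    and f_pos_semidef: "pos_semidef M \<Longrightarrow> pos_semidef (f M)"
    and f_pos_def: "pos_def M \<Longrightarrow> pos_def (f M)"
    and f_continuous: "continuous_on {M. pos_def M} f"
begin

lemma f_zero [simp]: "f 0 = 0"
  using f_add[of 0 0] by simp

lemma f_uminus: "f (- M) = - f M"
  using f_add[of M "- M"] by (simp add: add_eq_0_iff)

lemma f_diff: "f (M - N) = f M - f N"
  using f_add[of M "- N"] by (simp add: f_uminus)

lemma f_mat_1 [simp]: "f (mat 1) = mat 1"
  using f_mult[of "mat 1" "f (mat 1)"] by simp

lemma f_matrix_inv:
  assumes "invertible M"
  shows "invertible (f M)" "f (matrix_inv M) = matrix_inv (f M)"
proof -
  have "f M ** f (matrix_inv M) = mat 1"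
    by (simp add: f_mult[symmetric] matrix_inv_mult assms)
  from matrix_inv_unique_right[OF this]
  show "invertible (f M)" "f (matrix_inv M) = matrix_inv (f M)" by simp_all
qed

lemma invertible_f_iff: "invertible (f M) \<longleftrightarrow> invertible M"
  using f_matrix_inv(1)[of M] f_matrix_inv(1)[of "f M"] by auto

lemma f_mono: "X \<preceq> Y \<Longrightarrow> f X \<preceq> f Y"
  unfolding loewner_le_def f_diff[symmetric] by (rule f_pos_semidef)

text \<open>
  A Hermitian matrix is a combination of squares of Hermitian matrices,
  \<open>2 M = (M + 1)\<^sup>2 - M\<^sup>2 - 1\<close>, and squares of Hermitian matrices are positive semidefinite.
\<close>

lemma f_hermitian:
  assumes "hermitian M"
  shows "hermitian (f M)"
proof -
  have square: "hermitian (f (S ** S))" if "hermitian S" for S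
  proof -
    have one: "pos_semidef (mat 1 :: 'a ^ 'n ^ 'n)"
    proof -
      have "0 \<le> ip x x" for x :: "'a ^ 'n"
      proof -
        have "ip x x = (\<Sum>i\<in>UNIV. (norm (x $ i))\<^sup>2)"
          by (simp add: ip_def re_part_sum mult.commute[of "conjugate _"] mult_conjugate del: of_real_power)
        then show ?thesis by (simp add: sum_nonneg)
      qed
      then show ?thesis by (simp add: pos_semidef_iff hermitian_simps)
    qed
    have "pos_semidef (S ** S)"
      using pos_semidef_congruence[OF one, of S] that by (simp add: hermitian_def)
    then show ?thesis by (intro pos_semidef_hermitian f_pos_semidef)
  qed
  have M1: "hermitian (M + mat 1)" using assms by (simp add: hermitian_simps)
  have "M + M = (M + mat 1) ** (M + mat 1) - M ** M - mat 1"
    by (simp add: matrix_ring_simps)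
  then have "f M + f M = f ((M + mat 1) ** (M + mat 1)) - f (M ** M) - mat 1"
    unfolding f_add[symmetric] by (simp only: f_diff f_mat_1)
  then have "hermitian (f M + f M)"
    by (simp add: hermitian_simps square[OF M1] square[OF assms])
  then show ?thesis
    unfolding hermitian_def conj_transpose_add double_matrix_cancel .
qed

text \<open>
  Commutators of \<open>K\<close> with Hermitian matrices are Hermitian, and \<open>f\<close> preserves this.  As \<open>f\<close> maps
  the Hermitian matrices onto themselves, it follows that the Hermitian part \<open>D\<close> of \<open>2 f(K)\<close>
  commutes with all of them, and so is a scalar \<open>c\<close>.  Since \<open>K\<^sup>2\<close> is
  Hermitian, so is \<open>(D + L)\<^sup>2\<close>, where \<open>L\<close> is the skew part; its skew part \<open>2 c L\<close> must vanish.
  If \<open>L = 0\<close>, then \<open>f(K)\<close> is Hermitian, hence so is \<open>K = f(f(K))\<close>, and \<open>K = 0\<close>.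
\<close>

lemma f_skew_hermitian:
  assumes K: "K\<^sup>H = - K"
  shows "(f K)\<^sup>H = - f K"
proof -
  define D where "D = f K + (f K)\<^sup>H"
  define L where "L = f K - (f K)\<^sup>H"
  have DL: "f K + f K = D + L" by (simp add: D_def L_def)
  have LH: "L\<^sup>H = - L" and DH: "D\<^sup>H = D"
    by (simp_all add: L_def D_def conj_transpose_simps)
  have comm: "D ** S = S ** D" if S: "hermitian S" for S
  proof -
    have fS: "(f S)\<^sup>H = f S" "S\<^sup>H = S" using f_hermitian[OF S] S by (simp_all add: hermitian_def)
    have "hermitian (K ** f S - f S ** K)"
      by (simp add: hermitian_def conj_transpose_simps K fS matrix_ring_simps)
    from f_hermitian[OF this] have "hermitian (f K ** S - S ** f K)"
      by (simp add: f_diff f_mult)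
    then show ?thesis
      by (simp add: hermitian_def conj_transpose_simps fS D_def matrix_ring_simps algebra_simps)
  qed
  then obtain c where c: "D = mat c" by (rule commutes_with_hermitian_imp_scalar) blast
  have central: "D ** M = M ** D" for M unfolding c mat_scalar_mult ..
  have "(K ** K)\<^sup>H = K ** K" by (simp add: conj_transpose_mult K matrix_ring_simps)
  then have "hermitian (f K ** f K)"
    using f_hermitian[of "K ** K"] by (simp add: hermitian_def f_mult)
  then have "hermitian ((f K + f K) ** (f K + f K))"
    unfolding matrix_ring_simps by (intro hermitian_simps(3))
  then have "hermitian ((D + L) ** (D + L))" by (simp only: DL)
  moreover have "(D + L) ** (D + L) = (D ** D + L ** L) + (D ** L + D ** L)"
    unfolding matrix_ring_simps central[of L, symmetric] by (simp only: add_ac)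
  moreover have "hermitian (D ** D + L ** L)"
    by (simp add: hermitian_def conj_transpose_simps LH DH matrix_ring_simps)
  ultimately have "hermitian ((D ** D + L ** L) + (D ** L + D ** L) - (D ** D + L ** L))"
    using hermitian_simps(4) by metis
  then have "hermitian (D ** L + D ** L)" by (simp only: add_diff_cancel_left')
  then have "(D ** L)\<^sup>H = D ** L"
    unfolding hermitian_def conj_transpose_add double_matrix_cancel .
  then have "D ** L = - (D ** L)"
    by (simp add: conj_transpose_mult LH DH central[of L] matrix_ring_simps)
  then have "D ** L = 0" unfolding matrix_eq_uminus_iff .
  then have "c = 0 \<or> L = 0" unfolding c mat_scalar_mult by (auto simp: vec_eq_iff)
  then have "D = 0"
  proof
    assume "c = 0"
    then show ?thesis by (simp add: c vec_eq_iff mat_def)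
  next
    assume "L = 0"
    then have "hermitian (f K)" by (simp add: L_def hermitian_def)
    from f_hermitian[OF this] have "K = - K" using K by (simp add: hermitian_def)
    then have "K = 0" unfolding matrix_eq_uminus_iff .
    then show ?thesis by (simp add: D_def)
  qed
  then have "f K + (f K)\<^sup>H = 0" by (simp only: D_def)
  then show ?thesis by (simp only: add_eq_0_iff)
qed

lemma f_conj_transpose: "f (M\<^sup>H) = (f M)\<^sup>H"
proof -
  define S where "S = M + M\<^sup>H"
  define K where "K = M - M\<^sup>H"
  have "hermitian S" by (simp add: hermitian_def S_def conj_transpose_simps add.commute)
  then have S: "(f S)\<^sup>H = f S" using f_hermitian by (simp add: hermitian_def)
  have "K\<^sup>H = - K" by (simp add: K_def conj_transpose_simps)
  then have K: "(f K)\<^sup>H = - f K" by (rule f_skew_hermitian)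
  have "M + M = S + K" "M\<^sup>H + M\<^sup>H = S - K" by (simp_all add: S_def K_def)
  then have "f M + f M = f S + f K" "f (M\<^sup>H) + f (M\<^sup>H) = f S - f K"
    unfolding f_add[symmetric] f_diff[symmetric] by simp_all
  then have "f (M\<^sup>H) + f (M\<^sup>H) = (f M)\<^sup>H + (f M)\<^sup>H"
    unfolding conj_transpose_add[symmetric] by (simp add: conj_transpose_add S K)
  then show ?thesis unfolding double_matrix_cancel .
qed

end


section \<open>The fixed-point map\<close>

context loewner_involution
begin

definition step :: "'a ^ 'n ^ 'n \<Rightarrow> 'a ^ 'n ^ 'n \<Rightarrow> 'a ^ 'n ^ 'n \<Rightarrow> 'a ^ 'n ^ 'n" where
  "step A Q X = Q - A\<^sup>H ** matrix_inv (f X) ** A"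

text \<open>
  A multiplicative involution preserves and reflects invertibility, so the condition on \<open>f X\<close> becomes one on \<open>X\<close>.
\<close>

lemma primal_solution_iff:
  "primal_solution f A Q X \<longleftrightarrow> invertible X \<and> step A Q X = X"
proof -
  have "X + T = Q \<longleftrightarrow> Q - T = X" for T
    by (simp only: diff_eq_eq) (rule eq_commute)
  then show ?thesis by (simp only: primal_solution_def step_def invertible_f_iff)
qed

lemma dual_solution_eq_primal_solution:
  "dual_solution f A Q = primal_solution f ((f A)\<^sup>H) Q"
proof
  fix X
  have "X = Q - T \<longleftrightarrow> X + T = Q" for T by (simp only: eq_diff_eq)
  then show "dual_solution f A Q X = primal_solution f ((f A)\<^sup>H) Q X"
    by (simp only: dual_solution_def primal_solution_def conj_transpose_conj_transpose)
qed

lemma f_step: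
  assumes "invertible X"
  shows "f (step A Q X) = f Q - (f A)\<^sup>H ** matrix_inv X ** f A"
proof -
  have "f (matrix_inv (f X)) = matrix_inv X"
    using f_matrix_inv(2)[of "f X"] assms by (simp add: invertible_f_iff)
  then show ?thesis by (simp add: step_def f_diff f_mult f_conj_transpose)
qed

lemma step_mono:
  assumes "pos_def X" "X \<preceq> X'"
  shows "step A Q X \<preceq> step A Q X'"
  unfolding step_def using assms
  by (intro loewner_le_diff_left loewner_le_congruence loewner_matrix_inv_antimono
      f_pos_def f_mono)

lemma step_le:
  assumes "pos_def X"
  shows "step A Q X \<preceq> Q"
proof -
  have "pos_semidef (A\<^sup>H ** matrix_inv (f X) ** A)"
    using assms
    by (intro pos_semidef_congruence pos_def_imp_pos_semidef pos_def_matrix_inv f_pos_def)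
  then show ?thesis by (simp add: loewner_le_def step_def)
qed

lemma step_invariant:
  assumes "pos_def Y" "Y \<preceq> step A Q Y" "Y \<preceq> X"
  shows "Y \<preceq> step A Q X"
  using assms(2) step_mono[OF assms(1,3)] by (rule loewner_le_trans)

lemma step_iterate_invariant:
  assumes "pos_def Y" "Y \<preceq> step A Q Y" "Y \<preceq> X"
  shows "Y \<preceq> (step A Q ^^ k) X"
  by (induction k) (simp_all add: assms(3) step_invariant[OF assms(1,2)])

lemma subsolution_le:
  assumes "pos_def Y" "Y \<preceq> step A Q Y"
  shows "Y \<preceq> Q"
  using assms(2) step_le[OF assms(1)] by (rule loewner_le_trans)


section \<open>Two steps at once\<close>

text \<open>
  Apply \<open>f\<close> to one step: \<open>f(F(X)) = f(Q) - f(A)\<^sup>H X\<^sup>-\<^sup>1 f(A)\<close> is a Schur complement whose companion is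
  \<open>X - f(A) f(Q)\<^sup>-\<^sup>1 f(A)\<^sup>H = X - B\<^sub>1\<close>.  The Woodbury identity, used in both directions, relates the two inverses.
  The hypotheses on \<open>X\<close> are invertibility only, because the formula is also applied to a Hermitian
  solution whose positivity is still to be shown.
\<close>

lemma two_steps:
  assumes Q: "hermitian Q" "invertible Q" and X: "invertible X" "invertible (step A Q X)"
  shows "invertible (X - B_init f A Q)"
    and "matrix_inv (X - B_init f A Q) = matrix_inv X
      + matrix_inv X ** f A ** matrix_inv (f (step A Q X)) ** (f A)\<^sup>H ** matrix_inv X"
    and "step A Q (step A Q X)
      = Q_init f A Q - (A_init f A Q)\<^sup>H ** matrix_inv (X - B_init f A Q) ** A_init f A Q"
proof -
  have fQ: "invertible (f Q)" and fQh: "(matrix_inv (f Q))\<^sup>H = matrix_inv (f Q)"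
    using Q hermitian_matrix_inv[OF f_hermitian[OF Q(1)]]
    by (simp_all add: invertible_f_iff hermitian_def)
  have S: "invertible (f Q - (f A)\<^sup>H ** matrix_inv X ** f A)"
    using X by (simp add: f_step[OF X(1), symmetric] invertible_f_iff)
  note inv = schur_complement_inverse[OF fQ X(1) S, folded B_init_def f_step[OF X(1)]]
  show "invertible (X - B_init f A Q)"
    and "matrix_inv (X - B_init f A Q) = matrix_inv X
      + matrix_inv X ** f A ** matrix_inv (f (step A Q X)) ** (f A)\<^sup>H ** matrix_inv X"
    by (rule inv)+
  have "matrix_inv (f (step A Q X)) = matrix_inv (f Q)
      + matrix_inv (f Q) ** (f A)\<^sup>H ** matrix_inv (X - B_init f A Q) ** f A ** matrix_inv (f Q)"
    using schur_complement_inverse(2)[OF X(1) fQ inv(1)[unfolded B_init_def]]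
    by (simp only: B_init_def f_step[OF X(1)])
  then show "step A Q (step A Q X)
      = Q_init f A Q - (A_init f A Q)\<^sup>H ** matrix_inv (X - B_init f A Q) ** A_init f A Q"
    unfolding step_def[of A Q "step A Q X"] Q_init_def A_init_def
    by (simp add: conj_transpose_mult fQh matrix_ring_simps diff_diff_eq)
qed

text \<open>
  Composition of the fractional maps \<open>X \<mapsto> Q\<^sub>k - A\<^sub>k\<^sup>H (X - B\<^sub>k)\<^sup>-\<^sup>1 A\<^sub>k\<close>.  The induction step feeds
  \<open>F\<^sup>2(X)\<close> into the formula for \<open>k\<close>; the matrix to invert becomes a Schur complement, whose companion is
  \<open>X - B\<^sub>k\<^sub>+\<^sub>1\<close>.  All inverses exist because the formula is used only above the subsolution \<open>Y\<close>: the pivot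
  \<open>Q\<^sub>1 - B\<^sub>k\<close> is covered by the induction hypothesis at \<open>X = Q\<^sub>1 = F(Q)\<close>.  The indices here start from 0.
\<close>

lemma iterate_formula:
  assumes Q: "hermitian Q" and Y: "pos_def Y" "Y \<preceq> step A Q Y" and X: "Y \<preceq> X"
  shows "invertible (X - B_seq f A Q k)"
    and "(step A Q ^^ (2 * k + 2)) X
      = Q_seq f A Q k - (A_seq f A Q k)\<^sup>H ** matrix_inv (X - B_seq f A Q k) ** A_seq f A Q k"
proof -
  have YQ: "Y \<preceq> Q" by (rule subsolution_le[OF Y])
  have Qi: "invertible Q" by (rule pos_def_invertible[OF pos_def_loewner_le[OF Y(1) YQ]])
  define A1 B1 Q1 where "A1 = A_init f A Q" and "B1 = B_init f A Q" and "Q1 = Q_init f A Q"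
  have YQ1: "Y \<preceq> Q1"
    using step_invariant[OF Y YQ] by (simp add: Q1_def Q_init_def step_def)
  have B1h: "hermitian B1"
    using hermitian_congruence[OF hermitian_matrix_inv[OF f_hermitian[OF Q]], of "(f A)\<^sup>H"] Qi
    by (simp add: B1_def B_init_def invertible_f_iff)
  have Q1h: "hermitian Q1"
    by (rule pos_def_hermitian[OF pos_def_loewner_le[OF Y(1) YQ1]])
  have two: "invertible (Z - B1)"
    "step A Q (step A Q Z) = Q1 - A1\<^sup>H ** matrix_inv (Z - B1) ** A1" if "Y \<preceq> Z" for Z
    unfolding A1_def B1_def Q1_def
    by (rule two_steps[OF Q Qi] pos_def_invertible[OF pos_def_loewner_le[OF Y(1)]] that
        step_invariant[OF Y])+
  have "hermitian (B_seq f A Q k) \<and> (\<forall>X. Y \<preceq> X \<longrightarrow> invertible (X - B_seq f A Q k) \<and>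
      (step A Q ^^ (2 * k + 2)) X
      = Q_seq f A Q k - (A_seq f A Q k)\<^sup>H ** matrix_inv (X - B_seq f A Q k) ** A_seq f A Q k)"
  proof (induction k)
    case 0
    show ?case
      using two B1h by (simp add: A1_def B1_def Q1_def)
  next
    case (Suc k)
    define Bk where "Bk = B_seq f A Q k"
    define D where "D = Q1 - Bk"
    have IH: "hermitian Bk" "\<And>Z. Y \<preceq> Z \<Longrightarrow> invertible (Z - Bk)"
      "\<And>Z. Y \<preceq> Z \<Longrightarrow> (step A Q ^^ (2 * k + 2)) Z
        = Q_seq f A Q k - (A_seq f A Q k)\<^sup>H ** matrix_inv (Z - Bk) ** A_seq f A Q k"
      using Suc by (auto simp: Bk_def)
    have D: "invertible D" "hermitian D"
      unfolding D_def by (rule IH(2)[OF YQ1], rule hermitian_simps(4)[OF Q1h IH(1)])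
    have Dh: "(matrix_inv D)\<^sup>H = matrix_inv D"
      using hermitian_matrix_inv[OF D(2,1)] by (simp add: hermitian_def)
    have BSuc: "B_seq f A Q (Suc k) = B1 + A1 ** matrix_inv D ** A1\<^sup>H"
      by (simp add: A1_def B1_def D_def Q1_def Bk_def)
    have ASuc: "A_seq f A Q (Suc k) = A1 ** matrix_inv D ** A_seq f A Q k"
      by (simp add: A1_def D_def Q1_def Bk_def)
    have QSuc: "Q_seq f A Q (Suc k)
        = Q_seq f A Q k - (A_seq f A Q k)\<^sup>H ** matrix_inv D ** A_seq f A Q k"
      by (simp add: D_def Q1_def Bk_def)
    have "hermitian (B_seq f A Q (Suc k))"
      unfolding BSuc
      using hermitian_congruence[OF hermitian_matrix_inv[OF D(2,1)], of "A1\<^sup>H"]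
      by (intro hermitian_simps(3) B1h) simp
    moreover have "invertible (X - B_seq f A Q (Suc k)) \<and>
      (step A Q ^^ (2 * Suc k + 2)) X = Q_seq f A Q (Suc k)
        - (A_seq f A Q (Suc k))\<^sup>H ** matrix_inv (X - B_seq f A Q (Suc k)) ** A_seq f A Q (Suc k)"
      if X: "Y \<preceq> X" for X
    proof -
      define T where "T = X - B_seq f A Q (Suc k)"
      have T: "T = (X - B1) - A1 ** matrix_inv D ** A1\<^sup>H"
        by (simp only: T_def BSuc diff_diff_eq)
      define X2 where "X2 = step A Q (step A Q X)"
      have YX2: "Y \<preceq> X2" unfolding X2_def by (intro step_invariant[OF Y] X)
      have X2: "X2 - Bk = D - A1\<^sup>H ** matrix_inv (X - B1) ** A1"
        unfolding X2_def two(2)[OF X] D_def by (simp add: algebra_simps)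
      have S: "invertible (D - A1\<^sup>H ** matrix_inv (X - B1) ** A1)"
        unfolding X2[symmetric] by (rule IH(2)[OF YX2])
      have Ti: "invertible T"
        unfolding T by (rule schur_complement_inverse(1)[OF D(1) two(1)[OF X] S])
      have inv: "matrix_inv (X2 - Bk)
          = matrix_inv D + matrix_inv D ** A1\<^sup>H ** matrix_inv T ** A1 ** matrix_inv D"
        unfolding X2 T
        by (rule schur_complement_inverse(2)[OF two(1)[OF X] D(1) Ti[unfolded T]])
      have "(step A Q ^^ (2 * Suc k + 2)) X = (step A Q ^^ (2 * k + 2)) X2"
        by (simp add: X2_def funpow_swap1)
      also have "\<dots> = Q_seq f A Q (Suc k)
          - (A_seq f A Q (Suc k))\<^sup>H ** matrix_inv T ** A_seq f A Q (Suc k)"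
        unfolding IH(3)[OF YX2] inv QSuc ASuc
        by (simp add: conj_transpose_mult Dh matrix_ring_simps diff_diff_eq)
      finally show ?thesis using Ti by (simp only: T_def)
    qed
    ultimately show ?case by blast
  qed
  then show "invertible (X - B_seq f A Q k)"
    and "(step A Q ^^ (2 * k + 2)) X
      = Q_seq f A Q k - (A_seq f A Q k)\<^sup>H ** matrix_inv (X - B_seq f A Q k) ** A_seq f A Q k"
    using X by blast+
qed

text \<open>
  The recursion for \<open>Q_seq\<close> is the formula for iterates evaluated at \<open>X = F(Q)\<close>.
\<close>

lemma Q_seq_eq_iterate:
  assumes "hermitian Q" "pos_def Y" "Y \<preceq> step A Q Y"
  shows "Q_seq f A Q k = (step A Q ^^ (2 * k + 1)) Q"
proof -
  have Q1: "Q_init f A Q = step A Q Q" by (simp add: Q_init_def step_def)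
  show ?thesis
  proof (cases k)
    case 0
    then show ?thesis by (simp add: Q1)
  next
    case (Suc j)
    have "Y \<preceq> step A Q Q"
      by (rule step_invariant[OF assms(2,3) subsolution_le[OF assms(2,3)]])
    from iterate_formula(2)[OF assms this, of j]
    have "Q_seq f A Q (Suc j) = (step A Q ^^ (2 * j + 2)) (step A Q Q)" by (simp only: Q1 Q_seq.simps)
    also have "\<dots> = (step A Q ^^ (2 * Suc j + 1)) Q" by (simp add: funpow_swap1)
    finally show ?thesis using Suc by simp
  qed
qed

text \<open>
  For the dual data the initial triple is \<open>(A\<^sub>1\<^sup>H, Q - Q\<^sub>1, Q - B\<^sub>1)\<close>.  With it, one step of the
  recursion for \<open>B_seq\<close> is a double step of the dual fixed-point map applied to \<open>Q - B\<^sub>k\<close>.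
\<close>

lemma B_seq_eq_dual_iterate:
  assumes Q: "hermitian Q" and Y: "pos_def Y" "Y \<preceq> step ((f A)\<^sup>H) Q Y"
  shows "Q - B_seq f A Q k = (step ((f A)\<^sup>H) Q ^^ (2 * k + 1)) Q"
proof (induction k)
  case 0
  show ?case by (simp add: step_def B_init_def)
next
  case (Suc k)
  let ?A = "(f A)\<^sup>H"
  have YQ: "Y \<preceq> Q" by (rule subsolution_le[OF Y])
  have Qi: "invertible Q" by (rule pos_def_invertible[OF pos_def_loewner_le[OF Y(1) YQ]])
  have fQh: "(matrix_inv (f Q))\<^sup>H = matrix_inv (f Q)"
    using Qi hermitian_matrix_inv[OF f_hermitian[OF Q]]
    by (simp add: invertible_f_iff hermitian_def)
  have fA: "f ?A = A\<^sup>H" by (simp add: f_conj_transpose)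
  have init: "A_init f ?A Q = (A_init f A Q)\<^sup>H" "B_init f ?A Q = Q - Q_init f A Q"
    "Q_init f ?A Q = Q - B_init f A Q"
    by (simp_all add: A_init_def B_init_def Q_init_def fA conj_transpose_mult fQh matrix_mul_assoc)
  define X where "X = Q - B_seq f A Q k"
  have YX: "Y \<preceq> X" unfolding X_def Suc by (rule step_iterate_invariant[OF Y YQ])
  have XB: "X - B_init f ?A Q = Q_init f A Q - B_seq f A Q k"
    by (simp add: X_def init)
  have "step ?A Q (step ?A Q X)
      = Q_init f ?A Q - (A_init f ?A Q)\<^sup>H ** matrix_inv (X - B_init f ?A Q) ** A_init f ?A Q"
    by (rule two_steps(3)[OF Q Qi] pos_def_invertible[OF pos_def_loewner_le[OF Y(1)]]
        YX step_invariant[OF Y])+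
  then have "step ?A Q (step ?A Q X) = Q - B_seq f A Q (Suc k)"
    unfolding XB unfolding init by (simp only: conj_transpose_conj_transpose diff_diff_eq B_seq.simps)
  then show ?case using Suc by (simp add: X_def)
qed


section \<open>Extremal solutions\<close>

text \<open>
  The shift \<open>X \<mapsto> X - B\<^sub>1\<close> turns the two-step equation into \<open>W + A\<^sub>1\<^sup>H W\<^sup>-\<^sup>1 A\<^sub>1 = Q\<^sub>1 - B\<^sub>1\<close>, and the
  subsolution \<open>Y\<close> into a positive definite subsolution \<open>Y - B\<^sub>1\<close> of it.  Its positivity is read off from its
  inverse, which by the Woodbury identity is \<open>Y\<^sup>-\<^sup>1\<close> plus a positive semidefinite matrix.
\<close>

lemma hermitian_primal_solution_pos_def:
  assumes Q: "hermitian Q" and Y: "pos_def Y" "Y \<preceq> step A Q Y"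
    and X: "hermitian X" "primal_solution f A Q X"
  shows "pos_def X"
proof -
  define A1 B1 Q1 where "A1 = A_init f A Q" and "B1 = B_init f A Q" and "Q1 = Q_init f A Q"
  have Qpd: "pos_def Q" by (rule pos_def_loewner_le[OF Y(1) subsolution_le[OF Y]])
  have Qi: "invertible Q" by (rule pos_def_invertible[OF Qpd])
  have B1: "pos_semidef B1"
    using pos_semidef_congruence[OF pos_def_imp_pos_semidef[OF
        pos_def_matrix_inv[OF f_pos_def[OF Qpd]]], of "(f A)\<^sup>H"]
    by (simp add: B1_def B_init_def)
  have Xi: "invertible X" and Xfix: "step A Q X = X"
    using X(2) by (simp_all add: primal_solution_iff)
  have W: "invertible (X - B1)" "X = Q1 - A1\<^sup>H ** matrix_inv (X - B1) ** A1"
    using two_steps(1,3)[OF Q Qi Xi, of A] Xi by (simp_all add: Xfix A1_def B1_def Q1_def)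
  have Yi: "invertible Y" "pos_def (step A Q Y)" "invertible (step A Q Y)"
    using Y pos_def_loewner_le pos_def_invertible by blast+
  have "matrix_inv (Y - B1) = matrix_inv Y
      + ((f A)\<^sup>H ** matrix_inv Y)\<^sup>H ** matrix_inv (f (step A Q Y)) ** ((f A)\<^sup>H ** matrix_inv Y)"
    using two_steps(2)[OF Q Qi Yi(1,3)] hermitian_matrix_inv[OF pos_def_hermitian[OF Y(1)] Yi(1)]
    by (simp add: B1_def conj_transpose_mult hermitian_def matrix_mul_assoc)
  also have "pos_def \<dots>"
    by (intro pos_def_add_pos_semidef pos_def_matrix_inv Y(1) pos_semidef_congruence
        pos_def_imp_pos_semidef f_pos_def Yi(2))
  finally have "pos_def (matrix_inv (matrix_inv (Y - B1)))" by (rule pos_def_matrix_inv)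
  moreover have Zi: "invertible (Y - B1)"
    using two_steps(1)[OF Q Qi Yi(1,3)] by (simp add: B1_def)
  ultimately have Z: "pos_def (Y - B1)" by (simp add: invertible_matrix_inv)
  have "Y \<preceq> step A Q (step A Q Y)" by (rule step_invariant[OF Y Y(2)])
  also have "\<dots> = Q1 - A1\<^sup>H ** matrix_inv (Y - B1) ** A1"
    using two_steps(3)[OF Q Qi Yi(1,3)] by (simp add: A1_def B1_def Q1_def)
  finally have "(Y - B1) + A1\<^sup>H ** matrix_inv (Y - B1) ** A1 \<preceq> Q1 - B1"
    by (simp add: loewner_le_def algebra_simps)
  also have "Q1 - B1 = (X - B1) + A1\<^sup>H ** matrix_inv (X - B1) ** A1"
    using W(2) by (simp add: algebra_simps)
  finally have "pos_def (X - B1)"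
    by (rule hermitian_solution_pos_def[OF
        hermitian_simps(4)[OF X(1) pos_semidef_hermitian[OF B1]] W(1) Z])
  from pos_def_add_pos_semidef[OF this B1] show ?thesis by simp
qed

text \<open>
  Monotone iteration from the upper bound \<open>Q\<close>.  A solution satisfies \<open>Z \<le> F(Z)\<close>, so once it is known to be positive
  definite it stays below all iterates, just as \<open>Y\<close> does.
\<close>

lemma iterates_converge_to_maximal_solution:
  assumes Q: "hermitian Q" and Y: "pos_def Y" "Y \<preceq> step A Q Y"
  shows "\<exists>L. (\<lambda>k. (step A Q ^^ k) Q) \<longlonglongrightarrow> L \<and> maximal_pd_solution (primal_solution f A Q) L"
proof -
  define X where "X k = (step A Q ^^ k) Q" for k
  have XSuc: "X (Suc k) = step A Q (X k)" for k by (simp add: X_def)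
  have YX: "Y \<preceq> X k" for k
    unfolding X_def by (rule step_iterate_invariant[OF Y subsolution_le[OF Y]])
  have Xpd: "pos_def (X k)" for k by (rule pos_def_loewner_le[OF Y(1) YX])
  have Xdec: "X (Suc k) \<preceq> X k" for k
  proof (induction k)
    case 0
    show ?case using step_le[OF Xpd[of 0]] by (simp add: X_def)
  next
    case (Suc k)
    then show ?case unfolding XSuc[of "Suc k"] by (subst (2) XSuc) (rule step_mono[OF Xpd])
  qed
  obtain L where L: "X \<longlonglongrightarrow> L"
    using loewner_decreasing_convergent[where M = X and Y = Y, OF pos_def_hermitian[OF Xpd] Xdec YX]
    unfolding convergent_def by blast
  have Lpd: "pos_def L" by (rule pos_def_loewner_le[OF Y(1) loewner_le_limit[OF L YX]])
  have fX: "(\<lambda>k. f (X k)) \<longlonglongrightarrow> f L"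
    by (rule continuous_on_tendsto_compose[OF f_continuous L]) (simp_all add: Lpd Xpd)
  define N where "N k = matrix_inv (f (X k))" for k
  have Npd: "pos_def (N k)" for k unfolding N_def by (intro pos_def_matrix_inv f_pos_def Xpd)
  have minus: "P \<preceq> P' \<Longrightarrow> - P' \<preceq> - P" for P P' :: "'a ^ 'n ^ 'n"
    by (simp add: loewner_le_def)
  \<comment> \<open>The inverses increase and are bounded by \<open>f(Y)\<^sup>-\<^sup>1\<close>, so they converge by the same monotonicity
      principle; their limit inverts \<open>f L\<close>, and this replaces continuity of inversion.\<close>
  have "convergent (\<lambda>k. - N k)"
  proof (rule loewner_decreasing_convergent)
    show "hermitian (- N k)" for k by (intro hermitian_simps(5) pos_def_hermitian Npd)
    show "- N (Suc k) \<preceq> - N k" for k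
      unfolding N_def by (intro minus loewner_matrix_inv_antimono f_pos_def Xpd f_mono Xdec)
    show "- matrix_inv (f Y) \<preceq> - N k" for k
      unfolding N_def by (intro minus loewner_matrix_inv_antimono f_pos_def Y(1) f_mono YX)
  qed
  then obtain N' where N': "N \<longlonglongrightarrow> N'"
    unfolding convergent_def using tendsto_minus_cancel_left by (metis minus_minus)
  have "f (X k) ** N k = mat 1" for k
    unfolding N_def by (intro matrix_inv_mult(1) pos_def_invertible f_pos_def Xpd)
  with tendsto_matrix_mult[OF fX N'] have "f L ** N' = mat 1"
    by (simp add: LIMSEQ_const_iff)
  then have "N \<longlonglongrightarrow> matrix_inv (f L)" using N' matrix_inv_unique_right(2) by metis
  then have "(\<lambda>k. Q - A\<^sup>H ** N k ** A) \<longlonglongrightarrow> step A Q L"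
    unfolding step_def by (intro tendsto_diff tendsto_const tendsto_matrix_mult)
  then have "(\<lambda>k. X (Suc k)) \<longlonglongrightarrow> step A Q L" by (simp only: XSuc step_def N_def)
  then have fixpoint: "step A Q L = L" by (rule LIMSEQ_unique) (rule LIMSEQ_Suc[OF L])
  have "Z \<preceq> L" if Z: "hermitian Z" "primal_solution f A Q Z" for Z
  proof -
    have Zpd: "pos_def Z" by (rule hermitian_primal_solution_pos_def[OF Q Y Z])
    have Zfix: "step A Q Z = Z" using Z(2) by (simp add: primal_solution_iff)
    have "Z \<preceq> X k" for k
      unfolding X_def
      by (rule step_iterate_invariant[OF Zpd _ subsolution_le[OF Zpd, of A]]) (simp_all add: Zfix)
    then show ?thesis by (rule loewner_le_limit[OF L])
  qed
  then have "maximal_pd_solution (primal_solution f A Q) L"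
    using Lpd fixpoint
    by (simp add: maximal_pd_solution_def primal_solution_iff pos_def_invertible)
  with L show ?thesis unfolding X_def by blast
qed

text \<open>
  The map \<open>X \<mapsto> A\<^sup>H f(X)\<^sup>-\<^sup>1 A\<close> is a bijection of the invertible matrices, and its inverse is the
  same map for the dual data.
\<close>

lemma dual_identity:
  assumes "invertible A" "invertible X"
  shows "invertible (A\<^sup>H ** matrix_inv (f X) ** A)"
    and "f A ** matrix_inv (f (A\<^sup>H ** matrix_inv (f X) ** A)) ** (f A)\<^sup>H = X"
proof -
  have fX: "invertible (f X)" and fA: "invertible (f A)"
    and ifX: "f (matrix_inv (f X)) = matrix_inv X"
    using assms f_matrix_inv(2)[of "f X"] by (simp_all add: invertible_f_iff)
  note fAH = conj_transpose_inv(1)[OF fA]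
  show "invertible (A\<^sup>H ** matrix_inv (f X) ** A)"
    by (intro invertible_mult conj_transpose_inv(1) assms(1) invertible_matrix_inv(1) fX)
  have "f (A\<^sup>H ** matrix_inv (f X) ** A) = ((f A)\<^sup>H ** matrix_inv X) ** f A"
    by (simp add: f_mult f_conj_transpose ifX)
  then have "matrix_inv (f (A\<^sup>H ** matrix_inv (f X) ** A))
      = matrix_inv (f A) ** (X ** matrix_inv ((f A)\<^sup>H))"
    using fAH fA assms(2)
    by (simp add: matrix_inv_product invertible_mult invertible_matrix_inv)
  then have "f A ** matrix_inv (f (A\<^sup>H ** matrix_inv (f X) ** A)) ** (f A)\<^sup>H
      = (f A ** matrix_inv (f A)) ** X ** (matrix_inv ((f A)\<^sup>H) ** (f A)\<^sup>H)"
    by (simp only: matrix_mul_assoc)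
  then show "f A ** matrix_inv (f (A\<^sup>H ** matrix_inv (f X) ** A)) ** (f A)\<^sup>H = X"
    by (simp add: matrix_inv_mult fA fAH)
qed

text \<open>
  The defect \<open>F(Y) - Y\<close> of the primal subsolution is equal to the defect of its dual image.
\<close>

lemma dual_subsolution:
  assumes A: "invertible A" and Y: "pos_def Y" "Y \<preceq> step A Q Y"
  defines "Y' \<equiv> A\<^sup>H ** matrix_inv (f Y) ** A"
  shows "pos_def Y'" "Y' \<preceq> step ((f A)\<^sup>H) Q Y'"
proof -
  show "pos_def Y'"
    unfolding Y'_def by (intro pos_def_congruence pos_def_matrix_inv f_pos_def Y(1) A)
  have dual: "step ((f A)\<^sup>H) Q Y' = Q - Y"
    using dual_identity(2)[OF A pos_def_invertible[OF Y(1)]] by (simp add: step_def Y'_def)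
  have swap: "Q - Y - Y' = step A Q Y - Y"
    unfolding step_def Y'_def by (simp add: algebra_simps)
  show "Y' \<preceq> step ((f A)\<^sup>H) Q Y'"
    using Y(2) unfolding loewner_le_def dual swap .
qed

text \<open>
  On solutions, \<open>Q - X\<close> is the image of \<open>X\<close> under the bijection between primal and dual matrices.
  Hence \<open>X \<mapsto> Q - X\<close> exchanges primal and dual Hermitian solutions and reverses their order.
\<close>

lemma minimal_primal_of_maximal_dual:
  assumes Q: "hermitian Q" and A: "invertible A"
    and X: "maximal_pd_solution (dual_solution f A Q) X"
  shows "minimal_pd_solution (primal_solution f A Q) (Q - X)"
proof -
  have Xpd: "pos_def X" and Xmax: "\<And>Z. hermitian Z \<Longrightarrow> dual_solution f A Q Z \<Longrightarrow> Z \<preceq> X"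
    and Xsol: "X = Q - f A ** matrix_inv (f X) ** (f A)\<^sup>H"
    using X by (auto simp: maximal_pd_solution_def dual_solution_def)
  have fA: "invertible ((f A)\<^sup>H)"
    using A by (simp add: conj_transpose_inv(1) invertible_f_iff)
  have QX: "Q - X = ((f A)\<^sup>H)\<^sup>H ** matrix_inv (f X) ** (f A)\<^sup>H"
    by (subst (1) Xsol) simp
  have "pos_def (Q - X)"
    unfolding QX by (intro pos_def_congruence pos_def_matrix_inv f_pos_def Xpd fA)
  moreover have "primal_solution f A Q (Q - X)"
  proof -
    note dual = dual_identity[OF fA pos_def_invertible[OF Xpd], folded QX]
    have "A\<^sup>H ** matrix_inv (f (Q - X)) ** A = X"
      using dual(2) by (simp add: f_conj_transpose)
    with dual(1) show ?thesis by (simp add: primal_solution_def invertible_f_iff)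
  qed
  moreover have "Q - X \<preceq> Z" if Z: "hermitian Z" "primal_solution f A Q Z" for Z
  proof -
    have Zi: "invertible Z" and QZ: "Q - Z = A\<^sup>H ** matrix_inv (f Z) ** A"
      using Z(2) by (auto simp: primal_solution_def invertible_f_iff)
    note dual = dual_identity[OF A Zi, folded QZ]
    have "dual_solution f A Q (Q - Z)"
      using dual by (simp add: dual_solution_def invertible_f_iff)
    from Xmax[OF hermitian_simps(4)[OF Q Z(1)] this] have "Q - X \<preceq> Q - (Q - Z)"
      by (rule loewner_le_diff_left)
    then show ?thesis by simp
  qed
  ultimately show ?thesis by (simp add: minimal_pd_solution_def)
qed

end

lemma LIMSEQ_odd_subsequence:
  "X \<longlonglongrightarrow> L \<Longrightarrow> (\<lambda>k. X (2 * k + 1)) \<longlonglongrightarrow> L" for X :: "nat \<Rightarrow> 'b :: topological_space"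
  using LIMSEQ_subseq_LIMSEQ[of X L "\<lambda>k. 2 * k + 1"] by (simp add: strict_mono_def o_def)


theorem theorem2p1:
  fixes f :: "'a :: real_or_complex ^ 'n ^ 'n \<Rightarrow> 'a ^ 'n ^ 'n"
    and A Q :: "'a ^ 'n ^ 'n"
  assumes a1: "\<And>M. f (f M) = M"
    and a2: "\<And>M N. f (M + N) = f M + f N"
    and a3: "\<And>M N. f (M ** N) = f M ** f N"
    and a4: "\<And>M. pos_semidef M \<Longrightarrow> pos_semidef (f M)"
    and Q: "hermitian Q"
    and f_pd: "\<And>M. pos_def M \<Longrightarrow> pos_def (f M)"
    and f_cont: "continuous_on {M. pos_def M} f"
    and S: "{X. pos_def X \<and> X \<preceq> Q - A\<^sup>H ** matrix_inv (f X) ** A} \<noteq> {}"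
  shows "(convergent (Q_seq f A Q) \<and>
            maximal_pd_solution (primal_solution f A Q) (lim (Q_seq f A Q))) \<and>
         (invertible A \<longrightarrow> convergent (B_seq f A Q) \<and>
            maximal_pd_solution (dual_solution f A Q) (Q - lim (B_seq f A Q))) \<and>
         (invertible A \<longrightarrow> convergent (B_seq f A Q) \<and>
            minimal_pd_solution (primal_solution f A Q) (lim (B_seq f A Q)))"
proof -
  interpret loewner_involution f
    by unfold_locales (fact a1 a2 a3 a4 f_pd f_cont)+
  from S obtain Y where Y: "pos_def Y" "Y \<preceq> step A Q Y"
    by (auto simp: step_def)
  obtain L where L: "(\<lambda>k. (step A Q ^^ k) Q) \<longlonglongrightarrow> L"
    and Lmax: "maximal_pd_solution (primal_solution f A Q) L"
    using iterates_converge_to_maximal_solution[OF Q Y] by blast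
  have "Q_seq f A Q \<longlonglongrightarrow> L"
    using LIMSEQ_odd_subsequence[OF L] by (simp only: Q_seq_eq_iterate[OF Q Y, symmetric])
  then have primal: "convergent (Q_seq f A Q)" "lim (Q_seq f A Q) = L"
    by (auto intro: convergentI limI)
  have dual: "convergent (B_seq f A Q) \<and>
      maximal_pd_solution (dual_solution f A Q) (Q - lim (B_seq f A Q))" if A: "invertible A"
  proof -
    note Y' = dual_subsolution[OF A Y]
    obtain L' where L': "(\<lambda>k. (step ((f A)\<^sup>H) Q ^^ k) Q) \<longlonglongrightarrow> L'"
      and max: "maximal_pd_solution (dual_solution f A Q) L'"
      using iterates_converge_to_maximal_solution[OF Q Y']
      unfolding dual_solution_eq_primal_solution by blast
    have "(\<lambda>k. Q - B_seq f A Q k) \<longlonglongrightarrow> L'"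
      using LIMSEQ_odd_subsequence[OF L'] by (simp only: B_seq_eq_dual_iterate[OF Q Y', symmetric])
    from tendsto_diff[OF tendsto_const[of Q] this] have "B_seq f A Q \<longlonglongrightarrow> Q - L'"
      by simp
    then have "convergent (B_seq f A Q)" "lim (B_seq f A Q) = Q - L'"
      by (auto intro: convergentI limI)
    with max show ?thesis by simp
  qed
  moreover have "minimal_pd_solution (primal_solution f A Q) (lim (B_seq f A Q))" if "invertible A"
    using minimal_primal_of_maximal_dual[OF Q that conjunct2[OF dual[OF that]]] by simp
  ultimately show ?thesis using primal Lmax by simp
qed

end
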